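(* On degree-zero forms, i.e. as linear operators on the quantum hyperboloid $\mathbb{H}^2_q=\Omega^0(\mathbb{H}^2_q)$, the left and the right quantum Laplacians coincide: $\square_q=\widehat\square_q$.
   Context: Fix $q\in(-1,1)\setminus\{0\}$; Sweedler notation is used. **Algebras.** $P=SU_q(1,1)$ is the unital $\ast$-algebra generated by $\alpha,\gamma$ with $\alpha^*\alpha-\gamma^*\gamma=1$, $\alpha\alpha^*-q^2\gamma\gamma^*=1$, $\gamma\gamma^*=\gamma^*\gamma$, $q\gamma\alpha=\alpha\gamma$, $q\gamma^*\alpha=\alpha\gamma^*$; it is a $\ast$-Hopf algebra with $\Delta(\alpha)=\alpha\otimes\alpha+q\gamma^*\otimes\gamma$, $\Delta(\gamma)=\gamma\otimes\alpha+\alpha^*\otimes\gamma$, $\epsilon(\alpha)=1$, $\epsilon(\gamma)=0$, $S(\alpha)=\alpha^*$, $S(\alpha^* )=\alpha$, $S(\gamma)=-q\gamma$, $S(\gamma^* )=-q^{-1}\gamma^*$. A linear basis of $P$ is $\{\alpha^m\gamma^k\gamma^{*l}: m\in\mathbb{Z},k,l\in\mathbb{N}_0\}$ with $\alpha^{-m}:=\alpha^{*m}$. $G=\mathbb{C}[z,z^{-1}]$ with $z^*=z^{-1}$, $\Delta'(z)=z\otimes z$; $j:P\to G$ is the $\ast$-Hopf morphism with $j(\alpha)=z$, $j(\gamma)=0$; $\Delta_P=(\mathrm{id}\otimes j)\Delta$; $\mathbb{H}^2_q=\{b\in P:\Delta_P(b)=b\otimes1\}$. **Calculus.** $\mathcal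 R_3\subseteq\ker\epsilon$ is the right ideal generated by $\gamma^2,\gamma^{*2},\gamma\gamma^*,\alpha\gamma-\gamma,\alpha\gamma^*-\gamma^*,\alpha^*\gamma-\gamma,\alpha^*\gamma^*-\gamma^*,q^2\alpha+\alpha^*-(1+q^2)1$. The associated left covariant first order $\ast$-calculus is $\Omega^1(P)=P\otimes(\ker\epsilon/\mathcal R_3)$, with $\pi(p)=[p-\epsilon(p)1]$, $dp=p^{(1)}\pi(p^{(2)})$, $\pi(a)\,p=p^{(1)}\,\pi(ap^{(2)}-\epsilon(a)p^{(2)})$, $\pi(p)^*=-\pi(S(p)^* )$. It is a free left $P$-module on $\eta_3=\pi(\alpha-\alpha^* )$, $\eta_+=\pi(\gamma)$, $\eta_-=q\pi(\gamma^* )$. $(\Omega^\bullet(P),d,\ast)$ is its universal differential envelope: $\bigotimes_P^\bullet\Omega^1(P)$ modulo the two-sided ideal generated by $\sum_i dg_i\otimes_P dh_i$ with $\sum_i g_i\,dh_i=0$; $(\vartheta\vartheta')^*=(-1)^{kl}\vartheta'^*\vartheta^*$ for degrees $k,l$. The base forms are the graded differential $\ast$-subalgebra $\Omega^\bullet(\mathbb{H}^2_q)\subseteq\Omega^\bullet(P)$ given by $\Omega^0(\mathbb{H}^2_q)=\mathbb{H}^2_q$, $\Omega^1(\mathbb{H}^2_q)=\{x\eta_-+y\eta_+:x,y\in P,\ \Delta_P(x)=x\otimes z^2,\ \Delta_P(y)=y\otimes z^{*2}\}$, $\Omega^2(\mathbb{H}^2_q)=\mathbb{H}^2_q\,\mathrm{dvol}$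 with $\mathrm{dvol}:=\eta_-\eta_+$. **Laplacians.** The left Hodge operator is the antilinear map with $\star_L(b)=b^*\mathrm{dvol}$, $\star_L(x\eta_-+y\eta_+)=-y^*\eta_-+x^*\eta_+$, $\star_L(b\,\mathrm{dvol})=b^*$; the right one is $\star_R=\star_L\circ\ast$. On $\Omega^{k+1}(\mathbb{H}^2_q)$ put $d^{\star_L}=(-1)^{k+1}\star_L^{-1}\circ d\circ\star_L$ and $d^{\star_R}=(-1)^{k+1}\star_R^{-1}\circ d\circ\star_R=\ast\circ d^{\star_L}\circ\ast$ (both zero on $\Omega^0$). Then $\square_q=d\circ d^{\star_L}+d^{\star_L}\circ d$ and $\widehat\square_q=d\circ d^{\star_R}+d^{\star_R}\circ d=\ast\circ\square_q\circ\ast$. *)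

theory Defs
  imports Complex_Main "HOL-Library.Poly_Mapping" "HOL-Library.Product_Plus"
begin

section \<open>Linear algebra: formal sums, tensor products, quotients\<close>

text \<open>
  Free complex vector spaces are types \<open>'a \<Rightarrow>\<^sub>0 complex\<close>. If \<open>'a\<close> is a monoid, this is the monoid
  algebra. Since \<open>q\<close> is a term parameter, spaces depending on \<open>q\<close> cannot be types; they are
  subquotients \<open>A/N\<close> of free spaces, whose elements are the cosets \<open>cls N x\<close> with \<open>x \<in> A\<close>.
\<close>

definition scl :: "complex \<Rightarrow> ('a \<Rightarrow>\<^sub>0 complex) \<Rightarrow> ('a \<Rightarrow>\<^sub>0 complex)" where
  "scl c f = Poly_Mapping.map ((*) c) f"

lemma lookup_scl [simp]: "Poly_Mapping.lookup (scl c f) x = c * Poly_Mapping.lookup f x"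
  unfolding scl_def by transfer (simp add: when_def)

lemma vector_space_scl: "vector_space (scl :: complex \<Rightarrow> ('a \<Rightarrow>\<^sub>0 complex) \<Rightarrow> _)"
  by standard (auto intro!: poly_mapping_eqI simp: lookup_add algebra_simps)

abbreviation cspan :: "('a \<Rightarrow>\<^sub>0 complex) set \<Rightarrow> ('a \<Rightarrow>\<^sub>0 complex) set" where
  "cspan \<equiv> module.span scl"

definition lin :: "('a \<Rightarrow> ('b \<Rightarrow>\<^sub>0 complex)) \<Rightarrow> ('a \<Rightarrow>\<^sub>0 complex) \<Rightarrow> ('b \<Rightarrow>\<^sub>0 complex)" where
  "lin \<phi> f = (\<Sum>k\<in>Poly_Mapping.keys f. scl (Poly_Mapping.lookup f k) (\<phi> k))"

definition antilin :: "('a \<Rightarrow> ('b \<Rightarrow>\<^sub>0 complex)) \<Rightarrow> ('a \<Rightarrow>\<^sub>0 complex) \<Rightarrow> ('b \<Rightarrow>\<^sub>0 complex)" where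
  "antilin \<phi> f = (\<Sum>k\<in>Poly_Mapping.keys f. scl (cnj (Poly_Mapping.lookup f k)) (\<phi> k))"

definition tens ::
    "('a \<Rightarrow>\<^sub>0 complex) \<Rightarrow> ('b \<Rightarrow>\<^sub>0 complex) \<Rightarrow> ('a \<times> 'b \<Rightarrow>\<^sub>0 complex)" (infixr "\<otimes>\<^sub>c" 75) where
  "f \<otimes>\<^sub>c g = (\<Sum>u\<in>Poly_Mapping.keys f. \<Sum>v\<in>Poly_Mapping.keys g.
     Poly_Mapping.single (u, v) (Poly_Mapping.lookup f u * Poly_Mapping.lookup g v))"

definition tmap :: "(('a \<Rightarrow>\<^sub>0 complex) \<Rightarrow> ('c \<Rightarrow>\<^sub>0 complex)) \<Rightarrow> (('b \<Rightarrow>\<^sub>0 complex) \<Rightarrow> ('d \<Rightarrow>\<^sub>0 complex)) \<Rightarrow>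
    ('a \<times> 'b \<Rightarrow>\<^sub>0 complex) \<Rightarrow> ('c \<times> 'd \<Rightarrow>\<^sub>0 complex)" where
  "tmap F G = lin (\<lambda>(u, v). F (Poly_Mapping.single u 1) \<otimes>\<^sub>c G (Poly_Mapping.single v 1))"

definition tspan :: "('a \<Rightarrow>\<^sub>0 complex) set \<Rightarrow> ('b \<Rightarrow>\<^sub>0 complex) set \<Rightarrow> ('a \<times> 'b \<Rightarrow>\<^sub>0 complex) set" where
  "tspan A B = cspan {a \<otimes>\<^sub>c b | a b. a \<in> A \<and> b \<in> B}"

text \<open>\<open>A/N \<otimes> B/M\<close> is \<open>tspan A B\<close> modulo the following subspace \<open>N \<otimes> B + A \<otimes> M\<close>.\<close>

definition tker :: "('a \<Rightarrow>\<^sub>0 complex) set \<Rightarrow> ('a \<Rightarrow>\<^sub>0 complex) set \<Rightarrow>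
    ('b \<Rightarrow>\<^sub>0 complex) set \<Rightarrow> ('b \<Rightarrow>\<^sub>0 complex) set \<Rightarrow> ('a \<times> 'b \<Rightarrow>\<^sub>0 complex) set" where
  "tker A N B M = cspan (tspan N B \<union> tspan A M)"

definition cls :: "'v::ab_group_add set \<Rightarrow> 'v \<Rightarrow> 'v set" where
  "cls N x = {x + n | n. n \<in> N}"

definition rep :: "'v set \<Rightarrow> 'v" where
  "rep X = (SOME x. x \<in> X)"

text \<open>
  \<open>lift N F\<close> is the map of quotients induced by a map \<open>F\<close> of representatives, with values taken
  modulo \<open>N\<close>; \<open>lift2\<close> is its binary version. All maps lifted below respect the cosets in question.
\<close>

definition lift :: "'w::ab_group_add set \<Rightarrow> ('v \<Rightarrow> 'w) \<Rightarrow> 'v set \<Rightarrow> 'w set" where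
  "lift N F X = cls N (F (rep X))"

definition lift2 :: "'w::ab_group_add set \<Rightarrow> ('u \<Rightarrow> 'v \<Rightarrow> 'w) \<Rightarrow> 'u set \<Rightarrow> 'v set \<Rightarrow> 'w set" where
  "lift2 N F X Y = cls N (F (rep X) (rep Y))"

section \<open>The free unital algebra on \<open>\<alpha>, \<alpha>\<^sup>*, \<gamma>, \<gamma>\<^sup>*\<close>\<close>

datatype gen = Al | AlS | Ga | GaS

datatype word = Word (letters: "gen list")

instantiation word :: monoid_add
begin
definition zero_word :: word where "0 = Word []"
definition plus_word :: "word \<Rightarrow> word \<Rightarrow> word" where "v + w = Word (letters v @ letters w)"
instance by standard (auto simp: zero_word_def plus_word_def)
end

type_synonym falg = "word \<Rightarrow>\<^sub>0 complex"
text \<open>As word pairs form the product monoid, the product of \<open>falg2\<close> is that of \<open>falg \<otimes> falg\<close>.\<close>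
type_synonym falg2 = "word \<times> word \<Rightarrow>\<^sub>0 complex"
type_synonym falg4 = "(word \<times> word) \<times> (word \<times> word) \<Rightarrow>\<^sub>0 complex"

definition gn :: "gen \<Rightarrow> falg" where
  "gn g = Poly_Mapping.single (Word [g]) 1"

abbreviation "al \<equiv> gn Al"
abbreviation "als \<equiv> gn AlS"
abbreviation "ga \<equiv> gn Ga"
abbreviation "gas \<equiv> gn GaS"

definition alg_ext :: "(gen \<Rightarrow> ('b::monoid_add \<Rightarrow>\<^sub>0 complex)) \<Rightarrow> falg \<Rightarrow> ('b \<Rightarrow>\<^sub>0 complex)" where
  "alg_ext h = lin (\<lambda>w. prod_list (map h (letters w)))"

definition antialg_ext :: "(gen \<Rightarrow> falg) \<Rightarrow> falg \<Rightarrow> falg" where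
  "antialg_ext h = lin (\<lambda>w. prod_list (rev (map h (letters w))))"

fun gen_star :: "gen \<Rightarrow> gen" where
  "gen_star Al = AlS"
| "gen_star AlS = Al"
| "gen_star Ga = GaS"
| "gen_star GaS = Ga"

definition fstar :: "falg \<Rightarrow> falg" where
  "fstar = antilin (\<lambda>w. Poly_Mapping.single (Word (rev (map gen_star (letters w)))) 1)"

section \<open>The \<open>*\<close>-Hopf algebra \<open>P = SU\<^sub>q(1,1)\<close>\<close>

definition su_rels :: "real \<Rightarrow> falg set" where
  "su_rels q =
    {als * al - gas * ga - 1,
     al * als - scl (of_real (q^2)) (ga * gas) - 1,
     ga * gas - gas * ga,
     scl (of_real q) (ga * al) - al * ga,
     scl (of_real q) (gas * al) - al * gas}"

text \<open>Generation as a \<open>*\<close>-algebra: the ideal is generated by the relations and their adjoints.\<close>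

definition su_ideal :: "real \<Rightarrow> falg set" where
  "su_ideal q = cspan {a * r * b | a r b. r \<in> su_rels q \<union> fstar ` su_rels q}"

definition SU11 :: "real \<Rightarrow> falg set set" where
  "SU11 q = range (cls (su_ideal q))"

definition SU11_star :: "real \<Rightarrow> falg set \<Rightarrow> falg set" where
  "SU11_star q = lift (su_ideal q) fstar"

definition SU11_uminus :: "real \<Rightarrow> falg set \<Rightarrow> falg set" where
  "SU11_uminus q = lift (su_ideal q) uminus"

fun gen_Delta :: "real \<Rightarrow> gen \<Rightarrow> falg2" where
  "gen_Delta q Al = al \<otimes>\<^sub>c al + scl (of_real q) (gas \<otimes>\<^sub>c ga)"
| "gen_Delta q AlS = als \<otimes>\<^sub>c als + scl (of_real q) (ga \<otimes>\<^sub>c gas)"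
| "gen_Delta q Ga = ga \<otimes>\<^sub>c al + als \<otimes>\<^sub>c ga"
| "gen_Delta q GaS = gas \<otimes>\<^sub>c als + al \<otimes>\<^sub>c gas"

definition Delta :: "real \<Rightarrow> falg \<Rightarrow> falg2" where
  "Delta q = alg_ext (gen_Delta q)"

fun gen_counit :: "gen \<Rightarrow> complex" where
  "gen_counit Al = 1"
| "gen_counit AlS = 1"
| "gen_counit Ga = 0"
| "gen_counit GaS = 0"

definition counit :: "falg \<Rightarrow> complex" where
  "counit f =
    (\<Sum>w\<in>Poly_Mapping.keys f. Poly_Mapping.lookup f w * prod_list (map gen_counit (letters w)))"

fun gen_antipode :: "real \<Rightarrow> gen \<Rightarrow> falg" where
  "gen_antipode q Al = als"
| "gen_antipode q AlS = al"
| "gen_antipode q Ga = scl (of_real (- q)) ga"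
| "gen_antipode q GaS = scl (of_real (- inverse q)) gas"

definition antipode :: "real \<Rightarrow> falg \<Rightarrow> falg" where
  "antipode q = antialg_ext (gen_antipode q)"

section \<open>The circle and the quantum hyperboloid\<close>

text \<open>The Laurent polynomials \<open>\<complex>[z, z\<^sup>-\<^sup>1]\<close> are the group algebra of the integers.\<close>

type_synonym laurent = "int \<Rightarrow>\<^sub>0 complex"

definition zpow :: "int \<Rightarrow> laurent" where
  "zpow n = Poly_Mapping.single n 1"

fun gen_j :: "gen \<Rightarrow> laurent" where
  "gen_j Al = zpow 1"
| "gen_j AlS = zpow (- 1)"
| "gen_j Ga = 0"
| "gen_j GaS = 0"

definition proj_j :: "falg \<Rightarrow> laurent" where
  "proj_j = alg_ext gen_j"

definition PG_ker :: "real \<Rightarrow> (word \<times> int \<Rightarrow>\<^sub>0 complex) set" where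
  "PG_ker q = tker UNIV (su_ideal q) UNIV {0}"

definition Delta_P :: "real \<Rightarrow> falg set \<Rightarrow> (word \<times> int \<Rightarrow>\<^sub>0 complex) set" where
  "Delta_P q = lift (PG_ker q) (\<lambda>f. tmap id proj_j (Delta q f))"

definition SU11_weight :: "real \<Rightarrow> int \<Rightarrow> falg set set" where
  "SU11_weight q n = {x \<in> SU11 q. Delta_P q x = lift (PG_ker q) (\<lambda>f. f \<otimes>\<^sub>c zpow n) x}"

definition hyperboloid :: "real \<Rightarrow> falg set set" where
  "hyperboloid q = {b \<in> SU11 q. Delta_P q b = lift (PG_ker q) (\<lambda>f. f \<otimes>\<^sub>c 1) b}"

section \<open>The first order calculus \<open>\<Omega>\<^sup>1(P) = P \<otimes> (ker \<epsilon> / R\<^sub>3)\<close>\<close>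

definition counit_ker :: "falg set" where
  "counit_ker = {a. counit a = 0}"

definition R3_gens :: "real \<Rightarrow> falg set" where
  "R3_gens q =
    {ga * ga, gas * gas, ga * gas,
     al * ga - ga, al * gas - gas, als * ga - ga, als * gas - gas,
     scl (of_real (q^2)) al + als - scl (of_real (1 + q^2)) 1}"

text \<open>The preimage in the free algebra of the right ideal \<open>R\<^sub>3\<close> of \<open>P\<close>.\<close>

definition R3 :: "real \<Rightarrow> falg set" where
  "R3 q = cspan ({r * a | r a. r \<in> R3_gens q} \<union> su_ideal q)"

text \<open>\<open>\<Omega>\<^sup>1(P)\<close> is \<open>Om1\<close> modulo \<open>Om1_ker q\<close>.\<close>

definition Om1 :: "falg2 set" where
  "Om1 = tspan UNIV counit_ker"

definition Om1_ker :: "real \<Rightarrow> falg2 set" where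
  "Om1_ker q = tker UNIV (su_ideal q) counit_ker (R3 q)"

definition qpi :: "falg \<Rightarrow> falg" where
  "qpi p = p - scl (counit p) 1"

definition lmul1 :: "falg \<Rightarrow> falg2 \<Rightarrow> falg2" where
  "lmul1 p w = (p \<otimes>\<^sub>c 1) * w"

text \<open>\<open>(p \<pi>(a)) p' = p p'\<^sub>(\<^sub>1\<^sub>) \<pi>(a p'\<^sub>(\<^sub>2\<^sub>))\<close> for \<open>a \<in> ker \<epsilon>\<close>.\<close>

definition rmul1 :: "real \<Rightarrow> falg2 \<Rightarrow> falg \<Rightarrow> falg2" where
  "rmul1 q w p = w * Delta q p"

definition d0 :: "real \<Rightarrow> falg \<Rightarrow> falg2" where
  "d0 q p = tmap id qpi (Delta q p)"

text \<open>\<open>(p \<pi>(a))\<^sup>* = - \<pi>(S(a)\<^sup>*) p\<^sup>*\<close>; if \<open>\<epsilon>(a) = 0\<close> then \<open>S(a)\<^sup>*\<close> itself represents \<open>\<pi>(S(a)\<^sup>*)\<close>.\<close>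

definition star1 :: "real \<Rightarrow> falg2 \<Rightarrow> falg2" where
  "star1 q = antilin (\<lambda>(u, v).
     - rmul1 q (1 \<otimes>\<^sub>c fstar (antipode q (Poly_Mapping.single v 1)))
               (fstar (Poly_Mapping.single u 1)))"

definition eta_plus :: falg2 where
  "eta_plus = 1 \<otimes>\<^sub>c qpi ga"

definition eta_minus :: "real \<Rightarrow> falg2" where
  "eta_minus q = scl (of_real q) (1 \<otimes>\<^sub>c qpi gas)"

definition d0_P :: "real \<Rightarrow> falg set \<Rightarrow> falg2 set" where
  "d0_P q = lift (Om1_ker q) (d0 q)"

definition star1_P :: "real \<Rightarrow> falg2 set \<Rightarrow> falg2 set" where
  "star1_P q = lift (Om1_ker q) (star1 q)"

section \<open>Degree two of the universal differential envelope\<close>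

definition balance :: "real \<Rightarrow> falg4 set" where
  "balance q = {rmul1 q w p \<otimes>\<^sub>c w' - w \<otimes>\<^sub>c lmul1 p w' | w p w'. w \<in> Om1 \<and> w' \<in> Om1}"

text \<open>Representatives of \<open>\<Sum>\<^sub>i dg\<^sub>i \<otimes>\<^sub>P dh\<^sub>i\<close> with \<open>\<Sum>\<^sub>i g\<^sub>i dh\<^sub>i = 0\<close>.\<close>

definition env_gens :: "real \<Rightarrow> falg4 set" where
  "env_gens q = {(\<Sum>(g, h)\<leftarrow>ghs. d0 q g \<otimes>\<^sub>c d0 q h) | ghs :: (falg \<times> falg) list.
                   (\<Sum>(g, h)\<leftarrow>ghs. lmul1 g (d0 q h)) \<in> Om1_ker q}"

definition lmul2 :: "falg \<Rightarrow> falg4 \<Rightarrow> falg4" where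
  "lmul2 p w = ((p \<otimes>\<^sub>c 1) \<otimes>\<^sub>c 1) * w"

definition rmul2 :: "real \<Rightarrow> falg4 \<Rightarrow> falg \<Rightarrow> falg4" where
  "rmul2 q w p = w * (1 \<otimes>\<^sub>c Delta q p)"

text \<open>
  \<open>\<Omega>\<^sup>2(P)\<close> is \<open>tspan Om1 Om1\<close> modulo \<open>Om2_ker q\<close>. The degree two part of the two-sided ideal of
  the tensor algebra is the \<open>P\<close>-bimodule generated by its generators, all of which have degree two.
\<close>

definition Om2_ker :: "real \<Rightarrow> falg4 set" where
  "Om2_ker q = cspan
     (tker Om1 (Om1_ker q) Om1 (Om1_ker q) \<union> balance q \<union>
      {rmul2 q (lmul2 a t) b | a t b. t \<in> env_gens q})"

text \<open>The differential of degree one, \<open>d (\<Sum>\<^sub>i g\<^sub>i dh\<^sub>i) = \<Sum>\<^sub>i dg\<^sub>i dh\<^sub>i\<close>.\<close>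

definition d1_P :: "real \<Rightarrow> falg2 set \<Rightarrow> falg4 set" where
  "d1_P q W = (THE V. \<exists>ghs :: (falg \<times> falg) list.
      W = cls (Om1_ker q) (\<Sum>(g, h)\<leftarrow>ghs. lmul1 g (d0 q h)) \<and>
      V = cls (Om2_ker q) (\<Sum>(g, h)\<leftarrow>ghs. d0 q g \<otimes>\<^sub>c d0 q h))"

text \<open>\<open>b dvol\<close> with \<open>dvol = \<eta>\<^sub>- \<eta>\<^sub>+\<close>.\<close>

definition times_dvol :: "real \<Rightarrow> falg set \<Rightarrow> falg4 set" where
  "times_dvol q = lift (Om2_ker q) (\<lambda>p. lmul2 p (eta_minus q \<otimes>\<^sub>c eta_plus))"

text \<open>\<open>x \<eta>\<^sub>- + y \<eta>\<^sub>+\<close>.\<close>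

definition form1 :: "real \<Rightarrow> falg set \<Rightarrow> falg set \<Rightarrow> falg2 set" where
  "form1 q = lift2 (Om1_ker q) (\<lambda>x y. lmul1 x (eta_minus q) + lmul1 y eta_plus)"

section \<open>Hodge operators and Laplacians\<close>

definition starL0 :: "real \<Rightarrow> falg set \<Rightarrow> falg4 set" where
  "starL0 q b = times_dvol q (SU11_star q b)"

definition starL1 :: "real \<Rightarrow> falg2 set \<Rightarrow> falg2 set" where
  "starL1 q w = (THE v. \<exists>x \<in> SU11_weight q 2. \<exists>y \<in> SU11_weight q (- 2).
      w = form1 q x y \<and> v = form1 q (SU11_uminus q (SU11_star q y)) (SU11_star q x))"

definition starR0 :: "real \<Rightarrow> falg set \<Rightarrow> falg4 set" where
  "starR0 q b = starL0 q (SU11_star q b)"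

definition starR1 :: "real \<Rightarrow> falg2 set \<Rightarrow> falg2 set" where
  "starR1 q w = starL1 q (star1_P q w)"

text \<open>The codifferentials from base one-forms to functions; the sign is \<open>(-1)\<^sup>k\<^sup>+\<^sup>1\<close> at \<open>k = 0\<close>.\<close>

definition codiffL :: "real \<Rightarrow> falg2 set \<Rightarrow> falg set" where
  "codiffL q w = SU11_uminus q (inv_into (hyperboloid q) (starL0 q) (d1_P q (starL1 q w)))"

definition codiffR :: "real \<Rightarrow> falg2 set \<Rightarrow> falg set" where
  "codiffR q w = SU11_uminus q (inv_into (hyperboloid q) (starR0 q) (d1_P q (starR1 q w)))"

text \<open>
  The Laplacians in degree zero. There the summand in which the codifferential is applied first
  is absent, because the codifferentials vanish on functions.
\<close>

definition laplaceL :: "real \<Rightarrow> falg set \<Rightarrow> falg set" where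
  "laplaceL q b = codiffL q (d0_P q b)"

definition laplaceR :: "real \<Rightarrow> falg set \<Rightarrow> falg set" where
  "laplaceR q b = codiffR q (d0_P q b)"

end

theory Submission
  imports Defs
begin

text \<open>
  The right action of \<open>P\<close> on \<open>ker \<epsilon> / R\<^sub>3\<close> is diagonal, so \<open>d p = \<partial>\<^sub>-p \<eta>\<^sub>- + \<partial>\<^sub>+p \<eta>\<^sub>+ + \<partial>\<^sub>3p \<pi>(\<alpha>)\<close>
  with twisted derivations \<open>\<partial>\<^sub>i\<close> that are already defined on the free algebra; there they satisfy
  \<open>\<partial>\<^sub>-\<partial>\<^sub>+ - q\<^sup>2\<partial>\<^sub>+\<partial>\<^sub>- = \<partial>\<^sub>3\<close> exactly, and \<open>\<partial>\<^sub>3\<close> vanishes in weight zero. In degree two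
  \<open>\<eta>\<^sub>+\<eta>\<^sub>- = - q\<^sup>2\<eta>\<^sub>-\<eta>\<^sub>+\<close>, so \<open>d(x\<eta>\<^sub>- + y\<eta>\<^sub>+) = (\<partial>\<^sub>-y - q\<^sup>2\<partial>\<^sub>+x) dvol\<close> for base forms. With
  \<open>\<partial>\<^sub>\<mp>(p\<^sup>*) = \<sigma>((\<partial>\<^sub>\<plusminus>p)\<^sup>*)\<close>, where \<open>\<sigma>\<close> scales weight \<open>n\<close> by \<open>q\<^sup>-\<^sup>n\<close>, the left Laplacian of \<open>b\<close> is
  \<open>- (\<partial>\<^sub>+\<partial>\<^sub>-b + q\<^sup>2\<partial>\<^sub>-\<partial>\<^sub>+b)\<close> and the right one is \<open>- (q\<^sup>-\<^sup>2\<partial>\<^sub>-\<partial>\<^sub>+b + q\<^sup>4\<partial>\<^sub>+\<partial>\<^sub>-b)\<close>; by the commutation rule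
  both are \<open>- (1 + q\<^sup>4)\<partial>\<^sub>+\<partial>\<^sub>-b\<close>. The volume coefficient is well defined because the functional
  reading it off kills the envelope relations \<open>\<Sum> dg dh\<close>, again by the commutation rule.
\<close>

section \<open>Linear maps of free vector spaces\<close>

abbreviation lk where "lk \<equiv> Poly_Mapping.lookup"
abbreviation sng where "sng \<equiv> Poly_Mapping.single"

interpretation cs: vector_space "scl :: complex \<Rightarrow> ('a \<Rightarrow>\<^sub>0 complex) \<Rightarrow> ('a \<Rightarrow>\<^sub>0 complex)"
  by (rule vector_space_scl)

lemma scl_single [simp]: "scl c (sng k d) = sng k (c * d)"
  by (rule poly_mapping_eqI) (simp add: lookup_single when_def)

lemma single_scl: "sng k c = scl c (sng k 1)"
  by simp

lemma sum_singles: "f = (\<Sum>k\<in>Poly_Mapping.keys f. sng k (lk f k))"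
  by (rule poly_mapping_eqI)
    (simp add: lookup_sum lookup_single when_def in_keys_iff)

text \<open>Only additivity is required, so antilinear maps are covered as well; in return the
  comparison on basis vectors runs over all coefficients.\<close>

lemma additive_eqI:
  assumes "additive F" "additive G" "\<And>k c. F (sng k c) = G (sng k c)"
  shows "F f = G f"
proof -
  have "F f = F (\<Sum>k\<in>Poly_Mapping.keys f. sng k (lk f k))" by (simp flip: sum_singles)
  also have "\<dots> = G (\<Sum>k\<in>Poly_Mapping.keys f. sng k (lk f k))"
    using assms by (simp add: additive.sum)
  finally show ?thesis by (simp flip: sum_singles)
qed

lemma free_induct [case_names zero add single]:
  fixes f :: "'a \<Rightarrow>\<^sub>0 complex"
  assumes "P 0" "\<And>f g. P f \<Longrightarrow> P g \<Longrightarrow> P (f + g)" "\<And>k c. P (sng k c)"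
  shows "P f"
proof -
  have "P (\<Sum>k\<in>S. sng k (lk f k))" if "finite S" for S
    using that by induction (auto intro: assms)
  from this[of "Poly_Mapping.keys f"] show ?thesis by (simp flip: sum_singles)
qed

text \<open>The support of a sum can be smaller than the union of the supports, so all three sums
  are first extended by zero terms to that union. Linear and antilinear extensions, functionals and
  tensor products get their additivity from here.\<close>

lemma additive_keys_sum:
  fixes \<phi> :: "'a \<Rightarrow> complex \<Rightarrow> 'c::ab_group_add"
  assumes "\<And>k. additive (\<phi> k)"
  shows "additive (\<lambda>f. \<Sum>k\<in>Poly_Mapping.keys f. \<phi> k (lk f k))"
proof (rule additive.intro)
  have *: "(\<Sum>k\<in>Poly_Mapping.keys h. \<phi> k (lk h k)) = (\<Sum>k\<in>S. \<phi> k (lk h k))"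
    if "finite S" "Poly_Mapping.keys h \<subseteq> S" for h S
    using that by (intro sum.mono_neutral_left)
      (auto simp: in_keys_iff additive.zero[OF assms])
  fix f g :: "'a \<Rightarrow>\<^sub>0 complex"
  let ?S = "Poly_Mapping.keys f \<union> Poly_Mapping.keys g"
  show "(\<Sum>k\<in>Poly_Mapping.keys (f + g). \<phi> k (lk (f + g) k)) =
    (\<Sum>k\<in>Poly_Mapping.keys f. \<phi> k (lk f k)) + (\<Sum>k\<in>Poly_Mapping.keys g. \<phi> k (lk g k))"
    using keys_add[of f g] *[of ?S f] *[of ?S g] *[of ?S "f + g"]
    by (simp add: lookup_add additive.add[OF assms] sum.distrib)
qed

lemma additive_lin: "additive (lin \<phi>)"
  unfolding lin_def by (rule additive_keys_sum) (simp add: additive_def cs.scale_left_distrib)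

interpretation lin: additive "lin \<phi>" for \<phi> by (rule additive_lin)

lemma lin_single [simp]: "lin \<phi> (sng k c) = scl c (\<phi> k)"
  by (simp add: lin_def)

lemma additive_scl: "additive (scl c)"
  by (simp add: additive_def cs.scale_right_distrib)

lemma lin_scl: "lin \<phi> (scl c f) = scl c (lin \<phi> f)"
  by (rule additive_eqI[of "\<lambda>f. lin \<phi> (scl c f)" "\<lambda>f. scl c (lin \<phi> f)"])
    (simp_all add: additive_def cs.scale_right_distrib lin.add)

lemma additive_antilin: "additive (antilin \<phi>)"
  unfolding antilin_def by (rule additive_keys_sum) (simp add: additive_def cs.scale_left_distrib)

interpretation antilin: additive "antilin \<phi>" for \<phi> by (rule additive_antilin)

lemma antilin_single [simp]: "antilin \<phi> (sng k c) = scl (cnj c) (\<phi> k)"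
  by (simp add: antilin_def)

lemma antilin_scl: "antilin \<phi> (scl c f) = scl (cnj c) (antilin \<phi> f)"
  by (rule additive_eqI[of "\<lambda>f. antilin \<phi> (scl c f)" "\<lambda>f. scl (cnj c) (antilin \<phi> f)"])
    (simp_all add: additive_def cs.scale_right_distrib antilin.add)

definition lfun :: "('a \<Rightarrow> complex) \<Rightarrow> ('a \<Rightarrow>\<^sub>0 complex) \<Rightarrow> complex" where
  "lfun \<phi> f = (\<Sum>k\<in>Poly_Mapping.keys f. lk f k * \<phi> k)"

lemma additive_lfun: "additive (lfun \<phi>)"
  unfolding lfun_def by (rule additive_keys_sum) (simp add: additive_def distrib_right)

interpretation lfun: additive "lfun \<phi>" for \<phi> by (rule additive_lfun)

lemma lfun_single [simp]: "lfun \<phi> (sng k c) = c * \<phi> k"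
  by (simp add: lfun_def)

lemma lfun_scl: "lfun \<phi> (scl c f) = c * lfun \<phi> f"
  by (rule additive_eqI[of "\<lambda>f. lfun \<phi> (scl c f)" "\<lambda>f. c * lfun \<phi> f"])
    (simp_all add: additive_def distrib_left cs.scale_right_distrib lfun.add)

section \<open>Bilinearity and multiplicativity of formal tensor products\<close>

lemma additive_tens_left: "additive (\<lambda>f. f \<otimes>\<^sub>c g)"
  unfolding tens_def
  by (rule additive_keys_sum) (simp add: additive_def distrib_right single_add sum.distrib)

lemma additive_tens_right: "additive (\<lambda>g. f \<otimes>\<^sub>c g)"
proof -
  have "(\<lambda>g. f \<otimes>\<^sub>c g) = (\<lambda>g. \<Sum>v\<in>Poly_Mapping.keys g. \<Sum>u\<in>Poly_Mapping.keys f.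
     sng (u, v) (lk f u * lk g v))"
    unfolding tens_def by (rule ext) (rule sum.swap)
  then show ?thesis
    by (rule ssubst) (rule additive_keys_sum,
      simp add: additive_def distrib_left single_add sum.distrib)
qed

interpretation tl: additive "\<lambda>f. f \<otimes>\<^sub>c g" for g by (rule additive_tens_left)
interpretation tr: additive "\<lambda>g. f \<otimes>\<^sub>c g" for f by (rule additive_tens_right)

lemma tens_single [simp]: "sng u c \<otimes>\<^sub>c sng v d = sng (u, v) (c * d)"
  by (simp add: tens_def)

lemma tens_scl_left: "scl c f \<otimes>\<^sub>c g = scl c (f \<otimes>\<^sub>c g)"
proof (induction f rule: free_induct)
  case (single k d)
  show ?case by (induction g rule: free_induct)
    (simp_all add: tr.zero tr.add cs.scale_right_distrib mult_ac)
qed (simp_all add: tl.zero tl.add cs.scale_right_distrib)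

lemma tens_scl_right: "f \<otimes>\<^sub>c scl c g = scl c (f \<otimes>\<^sub>c g)"
proof (induction f rule: free_induct)
  case (single k d)
  show ?case by (induction g rule: free_induct)
    (simp_all add: tr.zero tr.add cs.scale_right_distrib mult_ac)
qed (simp_all add: tl.zero tl.add cs.scale_right_distrib)

lemma scl_conv_mult: "scl c f = sng 0 c * f"
  by (simp add: scl_def mult_map_scale_conv_mult)

lemma scl_mult_left: "scl c f * g = scl c (f * g)" for f :: "'a::monoid_add \<Rightarrow>\<^sub>0 complex"
  by (simp add: scl_conv_mult mult.assoc)

lemma scl_mult_right: "f * scl c g = scl c (f * g)" for f :: "'a::monoid_add \<Rightarrow>\<^sub>0 complex"
proof (induction f rule: free_induct)
  case (single k d)
  show ?case
    by (induction g rule: free_induct)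
      (simp_all add: distrib_left cs.scale_right_distrib mult_single mult_ac)
qed (simp_all add: distrib_right cs.scale_right_distrib)

lemma tens_mult: "(a \<otimes>\<^sub>c b) * (c \<otimes>\<^sub>c d) = (a * c) \<otimes>\<^sub>c (b * d)"
  for a c :: "'a::monoid_add \<Rightarrow>\<^sub>0 complex" and b d :: "'b::monoid_add \<Rightarrow>\<^sub>0 complex"
proof (induction a rule: free_induct)
  case (single k x)
  show ?case
  proof (induction b rule: free_induct)
    case (single l y)
    show ?case
    proof (induction c rule: free_induct)
      case (single m z)
      show ?case
        by (induction d rule: free_induct)
          (simp_all add: tr.zero tr.add distrib_left mult_single ac_simps)
    qed (simp_all add: tl.zero tl.add distrib_left)
  qed (simp_all add: tr.zero tr.add distrib_right)
qed (simp_all add: tl.zero tl.add distrib_right)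

lemma tens_one: "1 \<otimes>\<^sub>c 1 = (1 :: 'a::monoid_add \<times> 'b::monoid_add \<Rightarrow>\<^sub>0 complex)"
proof -
  have "sng (0::'a) (1::complex) \<otimes>\<^sub>c sng (0::'b) 1 = sng 0 1"
    by (simp only: tens_single zero_prod_def) simp
  then show ?thesis by (simp only: single_one)
qed

lemma tens_induct [case_names zero add tens]:
  fixes X :: "'a \<times> 'b \<Rightarrow>\<^sub>0 complex"
  assumes "P 0" "\<And>X Y. P X \<Longrightarrow> P Y \<Longrightarrow> P (X + Y)" "\<And>a b. P (a \<otimes>\<^sub>c b)"
  shows "P X"
proof (induction X rule: free_induct)
  case (single k c)
  have "P (sng (fst k) c \<otimes>\<^sub>c sng (snd k) 1)" by (rule assms)
  then show ?case by simp
qed (use assms in auto)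

text \<open>This is \<open>id \<otimes> \<phi>\<close> for the functional with values
  \<open>\<phi>\<close> on the basis; the one-dimensional second leg is absorbed into the
  coefficients.\<close>

definition idt :: "('b \<Rightarrow> complex) \<Rightarrow> ('a \<times> 'b \<Rightarrow>\<^sub>0 complex) \<Rightarrow> ('a \<Rightarrow>\<^sub>0 complex)" where
  "idt \<phi> = lin (\<lambda>(u, v). sng u (\<phi> v))"

interpretation idt: additive "idt \<phi>" for \<phi>
  unfolding idt_def by (rule additive_lin)

lemma idt_scl: "idt \<phi> (scl c X) = scl c (idt \<phi> X)"
  by (simp add: idt_def lin_scl)

lemma idt_single [simp]: "idt \<phi> (sng (u, v) c) = sng u (c * \<phi> v)"
  by (simp add: idt_def)

lemma idt_tens [simp]: "idt \<phi> (a \<otimes>\<^sub>c b) = scl (lfun \<phi> b) a"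
proof (induction a rule: free_induct)
  case (single k x)
  show ?case by (induction b rule: free_induct)
      (simp_all add: tr.zero tr.add idt.zero idt.add lfun.zero lfun.add cs.scale_left_distrib
        distrib_left single_add mult_ac)
qed (simp_all add: tl.zero tl.add idt.zero idt.add cs.scale_right_distrib)

lemma additive_tmap: "additive (tmap F G)"
  unfolding tmap_def by (rule additive_lin)

interpretation tmap: additive "tmap F G" for F G by (rule additive_tmap)

lemma tmap_scl: "tmap F G (scl c X) = scl c (tmap F G X)"
  by (simp add: tmap_def lin_scl)

lemma tmap_single [simp]: "tmap F G (sng (u, v) c) = scl c (F (sng u 1) \<otimes>\<^sub>c G (sng v 1))"
  by (simp add: tmap_def)

lemma tmap_tens:
  assumes "additive G" "\<And>c x. G (scl c x) = scl c (G x)"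
  shows "tmap id G (a \<otimes>\<^sub>c b) = a \<otimes>\<^sub>c G b"
proof (induction a rule: free_induct)
  case (single k x)
  interpret G: additive G by fact
  show ?case
  proof (induction b rule: free_induct)
    case (single l y)
    have "sng k x \<otimes>\<^sub>c G (sng l y) = scl x (sng k 1) \<otimes>\<^sub>c scl y (G (sng l 1))"
      by (simp flip: assms(2))
    also have "\<dots> = tmap id G (sng k x \<otimes>\<^sub>c sng l y)"
      by (simp only: tens_scl_left tens_scl_right tens_single tmap_single cs.scale_scale
          id_apply mult.commute)
    finally show ?case ..
  qed (simp_all add: tr.zero tr.add tmap.zero tmap.add G.zero G.add)
qed (simp_all add: tl.zero tl.add tmap.zero tmap.add)

definition tmapr :: "(('b \<Rightarrow>\<^sub>0 complex) \<Rightarrow> ('d \<Rightarrow>\<^sub>0 complex)) \<Rightarrow>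
    ('a \<times> 'b \<Rightarrow>\<^sub>0 complex) \<Rightarrow> ('a \<times> 'd \<Rightarrow>\<^sub>0 complex)" where
  "tmapr = tmap id"

interpretation tmapr: additive "tmapr G" for G
  unfolding tmapr_def by (rule additive_tmap)

lemma tmapr_scl: "tmapr G (scl c X) = scl c (tmapr G X)"
  unfolding tmapr_def by (rule tmap_scl)

lemma tmapr_tens:
  assumes "additive G" "\<And>c x. G (scl c x) = scl c (G x)"
  shows "tmapr G (a \<otimes>\<^sub>c b) = a \<otimes>\<^sub>c G b"
  unfolding tmapr_def by (rule tmap_tens[OF assms])

lemma additive_o: "additive F \<Longrightarrow> additive G \<Longrightarrow> additive (\<lambda>x. F (G x))"
  by (simp add: additive_def)

subsection \<open>Spans and cosets\<close>

lemma tspan_tens: "a \<in> A \<Longrightarrow> b \<in> B \<Longrightarrow> a \<otimes>\<^sub>c b \<in> tspan A B"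
  unfolding tspan_def by (rule cs.span_base) auto

text \<open>The scalar map \<open>\<theta>\<close> is the identity for linear \<open>F\<close> and
  \<open>cnj\<close> for antilinear \<open>F\<close>, so one induction serves both.\<close>

lemma cspan_image:
  assumes "X \<in> cspan S" "\<And>x. x \<in> S \<Longrightarrow> F x \<in> V" "additive F"
    "\<And>c x. F (scl c x) = scl (\<theta> c) (F x)" "cs.subspace V"
  shows "F X \<in> V"
  using assms(1)
proof (induction rule: cs.span_induct_alt)
  case base
  then show ?case by (simp add: additive.zero[OF assms(3)] cs.subspace_0[OF assms(5)])
next
  case (step c x y)
  then show ?case
    by (simp add: additive.add[OF assms(3)] assms(2,4) cs.subspace_add[OF assms(5)]
        cs.subspace_scale[OF assms(5)])
qed

lemma subspace_tspan: "cs.subspace (tspan A B)"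
  unfolding tspan_def by (rule cs.subspace_span)

lemma subspace_tker: "cs.subspace (tker A N B M)"
  unfolding tker_def by (rule cs.subspace_span)

lemma tker_left: "a \<in> N \<Longrightarrow> b \<in> B \<Longrightarrow> a \<otimes>\<^sub>c b \<in> tker A N B M"
  unfolding tker_def by (rule cs.span_base) (simp add: tspan_tens)

lemma tker_right: "a \<in> A \<Longrightarrow> b \<in> M \<Longrightarrow> a \<otimes>\<^sub>c b \<in> tker A N B M"
  unfolding tker_def by (rule cs.span_base) (simp add: tspan_tens)

lemma tker_image:
  assumes "X \<in> tker A N B M" "additive F" "\<And>c x. F (scl c x) = scl c (F x)" "cs.subspace V"
    "\<And>a b. a \<in> N \<Longrightarrow> b \<in> B \<Longrightarrow> F (a \<otimes>\<^sub>c b) \<in> V"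
    "\<And>a b. a \<in> A \<Longrightarrow> b \<in> M \<Longrightarrow> F (a \<otimes>\<^sub>c b) \<in> V"
  shows "F X \<in> V"
  using assms(1) unfolding tker_def
proof (rule cspan_image)
  fix x assume "x \<in> tspan N B \<union> tspan A M"
  then show "F x \<in> V"
    unfolding tspan_def by (auto intro: cspan_image assms(2-5) assms(6))
qed (fact assms)+

lemma cls_eq_iff:
  assumes "cs.subspace N"
  shows "cls N x = cls N y \<longleftrightarrow> x - y \<in> N"
proof
  assume "cls N x = cls N y"
  moreover have "x \<in> cls N x"
    unfolding cls_def using cs.subspace_0[OF assms] by force
  ultimately obtain n where "x = y + n" "n \<in> N" unfolding cls_def by auto
  then show "x - y \<in> N" by simp
next
  assume *: "x - y \<in> N"
  show "cls N x = cls N y"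
  proof (intro set_eqI iffI)
    fix z assume "z \<in> cls N x"
    then obtain n where "z = x + n" "n \<in> N" unfolding cls_def by auto
    then show "z \<in> cls N y" unfolding cls_def
      using cs.subspace_add[OF assms *, of n] by (intro CollectI exI[of _ "x - y + n"]) auto
  next
    fix z assume "z \<in> cls N y"
    then obtain n where "z = y + n" "n \<in> N" unfolding cls_def by auto
    then show "z \<in> cls N x" unfolding cls_def
      using cs.subspace_diff[OF assms _ *, of n] by (intro CollectI exI[of _ "n - (x - y)"]) auto
  qed
qed

lemma rep_cls:
  assumes "cs.subspace N"
  shows "rep (cls N x) - x \<in> N"
proof -
  have "x \<in> cls N x"
    unfolding cls_def using cs.subspace_0[OF assms] by force
  then have "rep (cls N x) \<in> cls N x"
    unfolding rep_def by (rule someI)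
  then show ?thesis by (auto simp: cls_def)
qed

text \<open>\<open>lift\<close> applies \<open>F\<close> to an arbitrary representative, which
  differs from \<open>x\<close> by an element of \<open>N\<close>; additivity moves this error into
  \<open>M\<close>.\<close>

lemma lift_cls:
  assumes "cs.subspace N" "cs.subspace M" "additive F" "\<And>n. n \<in> N \<Longrightarrow> F n \<in> M"
  shows "lift M F (cls N x) = cls M (F x)"
  unfolding lift_def cls_eq_iff[OF assms(2)]
  using assms(4)[OF rep_cls[OF assms(1), of x]] by (simp add: additive.diff[OF assms(3)])

section \<open>Operators on the free algebra\<close>

text \<open>Words grow by left multiplication with one letter, so an identity between multiplicative
  maps or twisted derivations is checked on the four generators and propagated by a product
  rule.\<close>

lemma falg_induct [case_names one gen add scl]:
  fixes f :: falg
  assumes "P 1" "\<And>g f. P f \<Longrightarrow> P (gn g * f)" "\<And>f g. P f \<Longrightarrow> P g \<Longrightarrow> P (f + g)"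
    "\<And>c f. P f \<Longrightarrow> P (scl c f)"
  shows "P f"
proof (induction f rule: free_induct)
  case zero
  show ?case using assms(4)[OF assms(1), of 0] by simp
next
  case (single w c)
  have "P (sng (Word gs) 1)" for gs
  proof (induction gs)
    case Nil
    then show ?case using assms(1) by (simp flip: single_one zero_word_def)
  next
    case (Cons g gs)
    have "sng (Word (g # gs)) 1 = gn g * (sng (Word gs) 1 :: falg)"
      by (simp add: gn_def mult_single plus_word_def)
    with assms(2)[OF Cons] show ?case by simp
  qed
  from assms(4)[OF this, of c "letters w"] show ?case by simp
qed (use assms(3) in auto)

lemma letters_zero [simp]: "letters 0 = []"
  by (simp add: zero_word_def)

lemma letters_plus [simp]: "letters (v + w) = letters v @ letters w"
  by (simp add: plus_word_def)

lemma one_falg: "(1 :: falg) = sng 0 1"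
  by simp

interpretation alg_ext: additive "alg_ext h" for h
  unfolding alg_ext_def by (rule additive_lin)

lemma alg_ext_scl: "alg_ext h (scl c f) = scl c (alg_ext h f)"
  by (simp add: alg_ext_def lin_scl)

lemma alg_ext_one: "alg_ext h 1 = 1"
  unfolding one_falg alg_ext_def lin_single by simp

lemma alg_ext_gn: "alg_ext h (gn g) = h g"
  by (simp add: alg_ext_def gn_def)

lemma alg_ext_mult: "alg_ext h (a * b) = alg_ext h a * alg_ext h b"
proof (induction a rule: free_induct)
  case (single k c)
  show ?case
    by (induction b rule: free_induct)
      (simp_all add: alg_ext.zero alg_ext.add distrib_left,
       simp add: alg_ext_def mult_single scl_mult_left scl_mult_right)
qed (simp_all add: alg_ext.zero alg_ext.add distrib_right)

interpretation Delta: additive "Delta q" for q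
  unfolding Delta_def by (rule alg_ext.additive_axioms)

lemma Delta_scl: "Delta q (scl c f) = scl c (Delta q f)"
  and Delta_one [simp]: "Delta q 1 = 1"
  and Delta_gn [simp]: "Delta q (gn g) = gen_Delta q g"
  and Delta_mult: "Delta q (a * b) = Delta q a * Delta q b"
  by (simp_all add: Delta_def alg_ext_scl alg_ext_one alg_ext_gn alg_ext_mult)

interpretation fstar: additive fstar
  unfolding fstar_def by (rule additive_antilin)

lemma fstar_scl: "fstar (scl c f) = scl (cnj c) (fstar f)"
  by (simp add: fstar_def antilin_scl)

lemma fstar_single: "fstar (sng w c) = sng (Word (rev (map gen_star (letters w)))) (cnj c)"
  by (simp add: fstar_def)

lemma fstar_one [simp]: "fstar 1 = 1"
  unfolding one_falg fstar_single by (simp flip: zero_word_def)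

lemma fstar_gn [simp]: "fstar (gn g) = gn (gen_star g)"
  by (simp add: gn_def fstar_single)

lemma fstar_mult: "fstar (a * b) = fstar b * fstar a"
proof (induction a rule: free_induct)
  case (single k c)
  show ?case
    by (induction b rule: free_induct)
      (simp_all add: fstar.zero fstar.add distrib_left distrib_right,
       simp add: fstar_single mult_single plus_word_def mult_ac)
qed (simp_all add: fstar.zero fstar.add distrib_left distrib_right)

lemma gen_star_gen_star [simp]: "gen_star (gen_star g) = g"
  by (cases g) auto

lemma fstar_fstar [simp]: "fstar (fstar f) = f"
  by (induction f rule: falg_induct) (simp_all add: fstar_mult fstar.add fstar_scl)

subsection \<open>The grading\<close>

text \<open>The weight is the exponent of \<open>z\<close> in the right coaction of the circle, in
  which \<open>\<alpha>\<close> and \<open>\<gamma>\<close> both have degree 1; see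
  \<open>coact_gn\<close>.\<close>

fun gwt :: "gen \<Rightarrow> int" where
  "gwt Al = 1"
| "gwt AlS = - 1"
| "gwt Ga = 1"
| "gwt GaS = - 1"

definition wt :: "word \<Rightarrow> int" where
  "wt w = sum_list (map gwt (letters w))"

lemma wt_plus [simp]: "wt (v + w) = wt v + wt w"
  and wt_zero [simp]: "wt 0 = 0"
  by (simp_all add: wt_def)

definition Hom :: "int \<Rightarrow> falg set" where
  "Hom n = {f. \<forall>w\<in>Poly_Mapping.keys f. wt w = n}"

lemma Hom_single: "wt w = n \<Longrightarrow> sng w c \<in> Hom n"
  by (simp add: Hom_def)

lemma subspace_Hom: "cs.subspace (Hom n)"
proof (rule cs.subspaceI)
  show "x + y \<in> Hom n" if "x \<in> Hom n" "y \<in> Hom n" for x y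
    using that keys_add[of x y] by (auto simp: Hom_def)
  show "scl c x \<in> Hom n" if "x \<in> Hom n" for c x
    using that by (auto simp: Hom_def in_keys_iff)
qed (simp add: Hom_def)

lemma Hom_mult: "a \<in> Hom m \<Longrightarrow> b \<in> Hom n \<Longrightarrow> a * b \<in> Hom (m + n)"
  using keys_mult[of a b] by (fastforce simp: Hom_def)

lemma Hom_gn: "gn g \<in> Hom (gwt g)"
  by (simp add: Hom_def gn_def wt_def)

lemma Hom_one: "1 \<in> Hom 0"
  by (simp add: Hom_def)

lemma Hom_image:
  assumes "f \<in> Hom n" "additive F" "cs.subspace V"
    "\<And>w c. wt w = n \<Longrightarrow> F (sng w c) \<in> V"
  shows "F f \<in> V"
proof -
  have "F f = (\<Sum>w\<in>Poly_Mapping.keys f. F (sng w (lk f w)))"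
    by (subst (1) sum_singles) (rule additive.sum[OF assms(2)])
  also have "\<dots> \<in> V"
    using assms(1) by (intro cs.subspace_sum assms(3,4)) (auto simp: Hom_def)
  finally show ?thesis .
qed

lemma Hom_eqI:
  assumes "f \<in> Hom n" "additive F" "additive G"
    "\<And>w c. wt w = n \<Longrightarrow> F (sng w c) = G (sng w c)"
  shows "F f = G f"
proof -
  have "F f = F (\<Sum>w\<in>Poly_Mapping.keys f. sng w (lk f w))" by (simp flip: sum_singles)
  also have "\<dots> = (\<Sum>w\<in>Poly_Mapping.keys f. F (sng w (lk f w)))"
    by (rule additive.sum[OF assms(2)])
  also have "\<dots> = (\<Sum>w\<in>Poly_Mapping.keys f. G (sng w (lk f w)))"
    using assms(1,4) by (intro sum.cong) (auto simp: Hom_def)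
  also have "\<dots> = G (\<Sum>w\<in>Poly_Mapping.keys f. sng w (lk f w))"
    by (rule additive.sum[OF assms(3), symmetric])
  finally show ?thesis by (simp flip: sum_singles)
qed

lemma Hom_fstar: "f \<in> Hom n \<Longrightarrow> fstar f \<in> Hom (- n)"
proof (erule Hom_image[OF _ fstar.additive_axioms subspace_Hom])
  have "sum_list (map gwt (map gen_star gs)) = - sum_list (map gwt gs)" for gs
  proof (induction gs)
    case (Cons g gs)
    then show ?case by (cases g) auto
  qed simp
  then show "fstar (sng w c) \<in> Hom (- n)" if "wt w = n" for w c
    using that unfolding fstar_single
    by (intro Hom_single) (simp add: wt_def flip: rev_map del: map_map)
qed

subsection \<open>Twisted derivations\<close>

text \<open>
  The three coordinate functionals of \<open>ker \<epsilon> / R\<^sub>3\<close> with respect to \<open>\<eta>\<^sub>-\<close>, \<open>\<eta>\<^sub>+\<close> and \<open>\<pi>(\<alpha>)\<close>. Since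
  the right action of \<open>P\<close> on this space is diagonal, each of them is a derivation relative to
  the counit and a character.
\<close>

datatype dir = Minus | Plus | Three

text \<open>The condition on \<open>q^2\<close> says that \<open>tw Three\<close> differs from 1, as
  the quotient defining \<open>phi\<close> requires.\<close>

locale su11 =
  fixes q :: real
  assumes q_nonzero [simp]: "q \<noteq> 0" and q_sq: "q^2 \<noteq> 1"
begin

abbreviation Q :: complex where "Q \<equiv> complex_of_real q"

text \<open>The eigenvalues of right multiplication by \<open>\<alpha>\<close> on the three basis
  classes of \<open>ker \<epsilon> / R\<^sub>3\<close>, as confirmed in
  \<open>ev_gn\<close>.\<close>

primrec tw :: "dir \<Rightarrow> complex" where
  "tw Minus = inverse Q"
| "tw Plus = inverse Q"
| "tw Three = inverse (Q^2)"

lemma tw_nonzero [simp]: "tw i \<noteq> 0"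
  by (cases i) auto

fun kapg :: "dir \<Rightarrow> gen \<Rightarrow> complex" where
  "kapg i Al = tw i"
| "kapg i AlS = inverse (tw i)"
| "kapg i Ga = 0"
| "kapg i GaS = 0"

text \<open>The value \<open>inverse Q\<close> normalises \<open>chi Minus\<close> to 1 on
  \<open>scl Q gas\<close>. The value \<open>- (Q^2)\<close> is forced by the last generator of
  \<open>R\<^sub>3\<close>, which makes the class of \<open>als - 1\<close> equal to
  \<open>- (Q^2)\<close> times that of \<open>al - 1\<close>.\<close>

fun chig :: "dir \<Rightarrow> gen \<Rightarrow> complex" where
  "chig Minus g = (if g = GaS then inverse Q else 0)"
| "chig Plus g = (if g = Ga then 1 else 0)"
| "chig Three g = (if g = Al then 1 else if g = AlS then - (Q^2) else 0)"

definition epsw :: "word \<Rightarrow> complex" where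
  "epsw w = prod_list (map gen_counit (letters w))"

definition kapw :: "dir \<Rightarrow> word \<Rightarrow> complex" where
  "kapw i w = prod_list (map (kapg i) (letters w))"

text \<open>The twisted Leibniz rule \<open>chi_mult\<close>, read as a recursion that splits off
  the first letter.\<close>

primrec chil :: "dir \<Rightarrow> gen list \<Rightarrow> complex" where
  "chil i [] = 0"
| "chil i (g # gs) = chig i g * prod_list (map (kapg i) gs) + gen_counit g * chil i gs"

definition chiw :: "dir \<Rightarrow> word \<Rightarrow> complex" where
  "chiw i w = chil i (letters w)"

lemma chil_append: "chil i (gs @ hs) =
    chil i gs * prod_list (map (kapg i) hs) + prod_list (map gen_counit gs) * chil i hs"
  by (induction gs) (simp_all add: algebra_simps)

abbreviation kap :: "dir \<Rightarrow> falg \<Rightarrow> complex" where "kap i \<equiv> lfun (kapw i)"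
abbreviation chi :: "dir \<Rightarrow> falg \<Rightarrow> complex" where "chi i \<equiv> lfun (chiw i)"

lemma counit_eq: "lfun epsw = counit"
  by (rule ext) (simp add: lfun_def counit_def epsw_def)

lemma counit_mult: "counit (a * b) = counit a * counit b"
  unfolding counit_eq[symmetric]
proof (induction a rule: free_induct)
  case (single k c)
  show ?case by (induction b rule: free_induct)
      (simp_all add: lfun.zero lfun.add distrib_left mult_single epsw_def)
qed (simp_all add: lfun.zero lfun.add distrib_right)

lemma kap_mult: "kap i (a * b) = kap i a * kap i b"
proof (induction a rule: free_induct)
  case (single k c)
  show ?case by (induction b rule: free_induct)
      (simp_all add: lfun.zero lfun.add distrib_left mult_single kapw_def)
qed (simp_all add: lfun.zero lfun.add distrib_right)

lemma chi_mult: "chi i (a * b) = chi i a * kap i b + counit a * chi i b"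
  unfolding counit_eq[symmetric]
proof (induction a rule: free_induct)
  case (single k c)
  show ?case
  proof (induction b rule: free_induct)
    case (single l d)
    then show ?case
      by (simp add: mult_single chiw_def chil_append epsw_def kapw_def algebra_simps)
  qed (simp_all add: lfun.zero lfun.add distrib_left)
qed (simp_all add: lfun.zero lfun.add distrib_right)

sublocale counit: additive counit
  unfolding counit_eq[symmetric] by (rule additive_lfun)

lemma counit_scl: "counit (scl c f) = c * counit f"
  unfolding counit_eq[symmetric] by (rule lfun_scl)

lemma counit_gn [simp]: "counit (gn g) = gen_counit g"
  and kap_gn [simp]: "kap i (gn g) = kapg i g"
  and chi_gn [simp]: "chi i (gn g) = chig i g"
  by (simp_all add: gn_def epsw_def kapw_def chiw_def flip: counit_eq)

lemma counit_one [simp]: "counit 1 = 1"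
  and kap_one [simp]: "kap i 1 = 1"
  and chi_one [simp]: "chi i 1 = 0"
  unfolding one_falg counit_eq[symmetric] lfun_single
  by (simp_all add: epsw_def kapw_def chiw_def)

text \<open>The second leg of \<open>falg2\<close> carries a representative of
  \<open>ker \<epsilon> / R\<^sub>3\<close>. Representatives of one-forms are killed by
  \<open>E\<close>, and \<open>D i\<close> reads off their left coefficient along the basis form of
  direction \<open>i\<close>.\<close>

definition E :: "falg2 \<Rightarrow> falg" where "E = idt epsw"
definition K :: "dir \<Rightarrow> falg2 \<Rightarrow> falg" where "K i = idt (kapw i)"
definition D :: "dir \<Rightarrow> falg2 \<Rightarrow> falg" where "D i = idt (chiw i)"

sublocale E: additive E unfolding E_def by (rule idt.additive_axioms)
sublocale K: additive "K i" for i unfolding K_def by (rule idt.additive_axioms)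
sublocale D: additive "D i" for i unfolding D_def by (rule idt.additive_axioms)

lemma E_scl: "E (scl c X) = scl c (E X)"
  and K_scl: "K i (scl c X) = scl c (K i X)"
  and D_scl: "D i (scl c X) = scl c (D i X)"
  by (simp_all add: E_def K_def D_def idt_scl)

lemma E_tens [simp]: "E (a \<otimes>\<^sub>c b) = scl (counit b) a"
  and K_tens [simp]: "K i (a \<otimes>\<^sub>c b) = scl (kap i b) a"
  and D_tens [simp]: "D i (a \<otimes>\<^sub>c b) = scl (chi i b) a"
  by (simp_all add: E_def K_def D_def counit_eq)

lemma E_one [simp]: "E 1 = 1" and K_one [simp]: "K i 1 = 1" and D_one [simp]: "D i 1 = 0"
  by (simp_all flip: tens_one)

lemma E_mult: "E (X * Y) = E X * E Y"
proof (induction X rule: tens_induct)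
  case (tens a b)
  show ?case by (induction Y rule: tens_induct)
      (simp_all add: E.zero E.add distrib_left tens_mult counit_mult scl_mult_left scl_mult_right
        mult.commute)
qed (simp_all add: E.zero E.add distrib_right)

lemma K_mult: "K i (X * Y) = K i X * K i Y"
proof (induction X rule: tens_induct)
  case (tens a b)
  show ?case by (induction Y rule: tens_induct)
      (simp_all add: K.zero K.add distrib_left tens_mult kap_mult scl_mult_left scl_mult_right
        mult.commute)
qed (simp_all add: K.zero K.add distrib_right)

lemma D_mult: "D i (X * Y) = D i X * K i Y + E X * D i Y"
proof (induction X rule: tens_induct)
  case (tens a b)
  show ?case by (induction Y rule: tens_induct)
      (simp_all add: D.zero D.add K.zero K.add distrib_left tens_mult chi_mult scl_mult_left
        scl_mult_right mult.commute cs.scale_left_distrib)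
qed (simp_all add: D.zero D.add E.zero E.add distrib_right)

section \<open>The automorphisms \<open>sig i\<close> and the twisted derivations
  \<open>der i\<close>\<close>

definition sig :: "dir \<Rightarrow> falg \<Rightarrow> falg" where "sig i f = K i (Delta q f)"
definition der :: "dir \<Rightarrow> falg \<Rightarrow> falg" where "der i f = D i (Delta q f)"

sublocale sig: additive "sig i" for i
  unfolding sig_def by (rule additive_o[OF K.additive_axioms Delta.additive_axioms])
sublocale der: additive "der i" for i
  unfolding der_def by (rule additive_o[OF D.additive_axioms Delta.additive_axioms])

lemma sig_scl: "sig i (scl c f) = scl c (sig i f)"
  and der_scl: "der i (scl c f) = scl c (der i f)"
  by (simp_all add: sig_def der_def Delta_scl K_scl D_scl)

lemma sig_one [simp]: "sig i 1 = 1" and der_one [simp]: "der i 1 = 0"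
  by (simp_all add: sig_def der_def)

lemma sig_mult: "sig i (a * b) = sig i a * sig i b"
  by (simp add: sig_def Delta_mult K_mult)

text \<open>A counit axiom that holds before passing to the quotient. It makes the untwisted factor
  \<open>a\<close> appear in \<open>der_mult\<close>.\<close>

lemma E_Delta [simp]: "E (Delta q f) = f"
proof (induction f rule: falg_induct)
  case (gen g f)
  then show ?case
    by (cases g) (simp_all add: Delta_mult E_mult E.add E_scl)
qed (simp_all add: Delta.add Delta_scl E.add E_scl)

lemma der_mult: "der i (a * b) = der i a * sig i b + a * der i b"
  by (simp add: sig_def der_def Delta_mult D_mult)

lemma D_rmul: "D i (X * Delta q p) = D i X * sig i p + E X * der i p"
  by (simp add: D_mult sig_def der_def)

lemma sig_gn: "sig i (gn g) = scl (tw i powi gwt g) (gn g)"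
  by (cases g) (simp_all add: sig_def K.add K_scl)

lemma sig_gens [simp]:
  "sig i al = scl (tw i) al" "sig i als = scl (inverse (tw i)) als"
  "sig i ga = scl (tw i) ga" "sig i gas = scl (inverse (tw i)) gas"
  by (simp_all add: sig_gn)

lemma der_gens [simp]:
  "der Minus al = 0" "der Minus als = ga" "der Minus ga = 0" "der Minus gas = scl (inverse Q) al"
  "der Plus al = scl Q gas" "der Plus als = 0" "der Plus ga = als" "der Plus gas = 0"
  "der Three al = al" "der Three als = scl (- (Q^2)) als"
  "der Three ga = ga" "der Three gas = scl (- (Q^2)) gas"
  by (simp_all add: der_def D.add D_scl)

lemma sig_single: "sig i (sng w c) = sng w (c * tw i powi wt w)"
proof -
  have "sig i (sng (Word gs) 1) = sng (Word gs) (tw i powi wt (Word gs))" for gs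
  proof (induction gs)
    case Nil
    have "sng (Word []) 1 = (1 :: falg)" by (simp flip: zero_word_def)
    then show ?case by (simp add: wt_def)
  next
    case (Cons g gs)
    have *: "sng (Word (g # gs)) c = gn g * (sng (Word gs) c :: falg)" for c
      by (simp add: gn_def mult_single plus_word_def)
    show ?case
      unfolding * sig_mult Cons sig_gn
      by (simp add: scl_mult_left gn_def mult_single plus_word_def wt_def power_int_add)
  qed
  from this[of "letters w"] have "sig i (sng w 1) = sng w (tw i powi wt w)" by simp
  then show ?thesis
    using sig_scl[of i c "sng w 1"] by simp
qed

lemma sig_Hom: "f \<in> Hom n \<Longrightarrow> sig i f = scl (tw i powi n) f"
  by (erule Hom_eqI[OF _ sig.additive_axioms additive_scl]) (simp add: sig_single mult.commute)

text \<open>The shifts 2 and -2 are the weights prescribed for the coefficients of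
  \<open>\<eta>\<^sub>-\<close> and \<open>\<eta>\<^sub>+\<close> in base one-forms, so derivatives
  of weight-zero elements are admissible coefficients.\<close>

primrec shift :: "dir \<Rightarrow> int" where
  "shift Minus = 2"
| "shift Plus = - 2"
| "shift Three = 0"

lemma der_single_Hom: "der i (sng w c) \<in> Hom (wt w + shift i)"
proof -
  have g: "der i (gn g) \<in> Hom (gwt g + shift i)" for g
    using Hom_gn[of Al] Hom_gn[of AlS] Hom_gn[of Ga] Hom_gn[of GaS]
    by (cases i; cases g)
      (auto simp: cs.subspace_0[OF subspace_Hom] intro: cs.subspace_scale[OF subspace_Hom]
          cs.subspace_neg[OF subspace_Hom])
  have "der i (sng (Word gs) 1) \<in> Hom (wt (Word gs) + shift i)" for gs
  proof (induction gs)
    case Nil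
    have "sng (Word []) 1 = (1 :: falg)" by (simp flip: zero_word_def)
    then show ?case by (simp add: cs.subspace_0[OF subspace_Hom])
  next
    case (Cons g gs)
    have "sng (Word (g # gs)) 1 = gn g * (sng (Word gs) 1 :: falg)"
      by (simp add: gn_def mult_single plus_word_def)
    moreover have "der i (gn g) * sig i (sng (Word gs) 1) \<in> Hom ((gwt g + shift i) + wt (Word gs))"
      by (rule Hom_mult[OF g]) (simp add: sig_single Hom_single)
    moreover have "gn g * der i (sng (Word gs) 1) \<in> Hom (gwt g + (wt (Word gs) + shift i))"
      by (rule Hom_mult[OF Hom_gn Cons])
    moreover have "wt (Word (g # gs)) = gwt g + wt (Word gs)" by (simp add: wt_def)
    ultimately show ?case
      using cs.subspace_add[OF subspace_Hom] by (simp add: der_mult add_ac)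
  qed
  from cs.subspace_scale[OF subspace_Hom this[of "letters w"], of c]
  show ?thesis by (simp flip: der_scl)
qed

lemma Hom_der: "f \<in> Hom n \<Longrightarrow> der i f \<in> Hom (n + shift i)"
  by (erule Hom_image[OF _ der.additive_axioms subspace_Hom]) (metis der_single_Hom)

text \<open>On weight \<open>n\<close> the map \<open>sig j\<close> is the scalar
  \<open>tw j powi n\<close>, and \<open>der i\<close> moves the weight by \<open>shift i\<close>;
  the factor is the quotient of the two scalars involved.\<close>

lemma der_sig: "der i (sig j f) = scl (tw j powi (- shift i)) (sig j (der i f))"
proof (rule additive_eqI[of "\<lambda>f. der i (sig j f)"
      "\<lambda>f. scl (tw j powi (- shift i)) (sig j (der i f))"])
  fix w c
  have "sig j (der i (sng w c)) = scl (tw j powi (wt w + shift i)) (der i (sng w c))"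
    by (rule sig_Hom[OF der_single_Hom])
  moreover have "sig j (sng w c) = scl (tw j powi wt w) (sng w c)"
    by (rule sig_Hom) (simp add: Hom_single)
  ultimately show "der i (sig j (sng w c)) =
      scl (tw j powi (- shift i)) (sig j (der i (sng w c)))"
    by (simp add: der_scl power_int_minus power_int_add del: scl_single)
qed (simp_all add: additive_def der.add sig.add cs.scale_right_distrib)

lemma sig_fstar_sig: "sig i (fstar (sig i f)) = fstar f"
proof (rule additive_eqI[of "\<lambda>f. sig i (fstar (sig i f))"])
  fix w c
  have real: "cnj (tw i) = tw i" by (cases i) auto
  have "sig i (sng w c) = scl (tw i powi wt w) (sng w c)"
    and "sig i (fstar (sng w c)) = scl (tw i powi (- wt w)) (fstar (sng w c))"
    by (simp_all add: sig_Hom Hom_single Hom_fstar del: scl_single)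
  then show "sig i (fstar (sig i (sng w c))) = fstar (sng w c)"
    by (simp add: fstar_scl sig_scl power_int_minus real del: scl_single)
qed (simp_all add: additive_def fstar.add sig.add)

lemma sig_Plus: "sig Plus f = sig Minus f"
  by (rule additive_eqI[of "sig Plus"]) (simp_all add: sig.additive_axioms sig_single)

lemma sig_Three: "sig Three f = sig Minus (sig Minus f)"
  by (rule additive_eqI[of "sig Three"])
    (simp_all add: sig.additive_axioms additive_o sig_single power_int_mult_distrib
      power2_eq_square mult_ac)

text \<open>Since \<open>fstar\<close> reverses products, the two Leibniz summands change places.
  The twist that then sits on the wrong factor is removed by \<open>sig_fstar_sig\<close>, which
  holds because the star negates weights and the twists are real.\<close>

lemma der_fstar:
  "der Minus (fstar f) = sig Minus (fstar (der Plus f)) \<and>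
   der Plus (fstar f) = sig Minus (fstar (der Minus f))"
proof (induction f rule: falg_induct)
  case one
  show ?case by (simp add: fstar.zero sig.zero)
next
  case (gen g f)
  have "der Minus (fstar (gn g)) = sig Minus (fstar (der Plus (gn g))) \<and>
    der Plus (fstar (gn g)) = sig Minus (fstar (der Minus (gn g)))"
    by (cases g) (simp_all add: fstar_scl sig_scl fstar.zero sig.zero)
  then show ?case
    unfolding fstar_mult der_mult sig_Plus
    by (simp add: gen fstar.add sig.add fstar_mult sig_mult sig_fstar_sig)
next
  case (add f g)
  then show ?case by (simp add: fstar.add der.add sig.add)
next
  case (scl c f)
  then show ?case by (simp add: fstar_scl der_scl sig_scl)
qed

lemma der_Minus_fstar: "der Minus (fstar f) = sig Minus (fstar (der Plus f))"
  and der_Plus_fstar: "der Plus (fstar f) = sig Minus (fstar (der Minus f))"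
  using der_fstar by auto

text \<open>Both sides obey a Leibniz rule twisted by the square of \<open>sig Minus\<close>, which
  is \<open>sig Three\<close>. The mixed terms of the second derivatives cancel, because moving a
  derivation past \<open>sig Minus\<close> costs \<open>q^2\<close> for \<open>Minus\<close> and the
  inverse for \<open>Plus\<close>.\<close>

lemma der_commutator:
  "der Minus (der Plus f) - scl (Q^2) (der Plus (der Minus f)) = der Three f"
proof (induction f rule: falg_induct)
  case one
  show ?case by (simp add: der.zero)
next
  case (gen g f)
  let ?a = "gn g" and ?s = "sig Minus"
  have m: "der Minus (?s f) = scl (Q^2) (?s (der Minus f))"
    and p: "scl (Q^2) (der Plus (?s f)) = ?s (der Plus f)"
    by (simp_all add: der_sig power_int_minus power_inverse)
  have g: "der Minus (der Plus ?a) - scl (Q^2) (der Plus (der Minus ?a)) = der Three ?a"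
    by (cases g) (simp_all add: der_scl der.zero power2_eq_square)
  have "der Minus (der Plus (?a * f)) = der Minus (der Plus ?a) * ?s (?s f)
      + scl (Q^2) (der Plus ?a * ?s (der Minus f))
      + (der Minus ?a * ?s (der Plus f) + ?a * der Minus (der Plus f))"
    by (simp only: der_mult der.add sig_Plus m scl_mult_right)
  moreover have "scl (Q^2) (der Plus (der Minus (?a * f))) =
      scl (Q^2) (der Plus (der Minus ?a)) * ?s (?s f) + der Minus ?a * ?s (der Plus f)
      + (scl (Q^2) (der Plus ?a * ?s (der Minus f)) + ?a * scl (Q^2) (der Plus (der Minus f)))"
    by (simp only: der_mult der.add sig_Plus cs.scale_right_distrib scl_mult_right scl_mult_left
        flip: p)
  moreover have "der Three (?a * f) = (der Minus (der Plus ?a)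
      - scl (Q^2) (der Plus (der Minus ?a))) * ?s (?s f)
      + ?a * (der Minus (der Plus f) - scl (Q^2) (der Plus (der Minus f)))"
    by (simp only: der_mult sig_Three g gen)
  ultimately show ?case
    by (simp only:) (simp add: algebra_simps)
next
  case (add f g)
  then show ?case by (simp add: der.add cs.scale_right_distrib algebra_simps flip: add)
next
  case (scl c f)
  have "der Three (scl c f) = scl c (der Minus (der Plus f)
      - scl (Q^2) (der Plus (der Minus f)))"
    by (simp only: der_scl scl)
  then show ?case
    by (simp only:) (simp add: der_scl cs.scale_right_diff_distrib mult.commute)
qed

text \<open>A geometric sum in \<open>tw Three\<close>, in closed form so that negative weights are
  included. It satisfies \<open>phi (m + n) = phi m * tw Three powi n + phi n\<close>, which mirrors
  the Leibniz rule of \<open>der Three\<close>.\<close>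

definition phi :: "int \<Rightarrow> complex" where
  "phi n = (tw Three powi n - 1) / (tw Three - 1)"

lemma tw_Three: "tw Three \<noteq> 1"
proof
  assume "tw Three = 1"
  then have "Q^2 = 1" by simp
  then have "complex_of_real (q^2) = complex_of_real 1" by simp
  then show False using q_sq by (simp only: of_real_eq_iff)
qed

text \<open>The generators are eigenvectors of \<open>der Three\<close> and \<open>sig Three\<close>
  is diagonal, so each word is an eigenvector whose eigenvalue depends on its weight alone.\<close>

lemma der_Three_Hom: "f \<in> Hom n \<Longrightarrow> der Three f = scl (phi n) f"
proof (erule Hom_eqI[OF _ der.additive_axioms additive_scl])
  have "der Three (sng (Word gs) 1) = scl (phi (wt (Word gs))) (sng (Word gs) 1)" for gs
  proof (induction gs)
    case Nil
    have "sng (Word []) 1 = (1 :: falg)" by (simp flip: zero_word_def)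
    then show ?case by (simp add: wt_def phi_def del: scl_single)
  next
    case (Cons g gs)
    let ?w = "sng (Word gs) 1"
    have *: "sng (Word (g # gs)) 1 = gn g * (?w :: falg)"
      by (simp add: gn_def mult_single plus_word_def)
    have "phi (- 1) = - (Q^2)"
      using tw_Three by (simp add: phi_def divide_simps power_int_minus) (simp add: algebra_simps)
    then have "der Three (gn g) = scl (phi (gwt g)) (gn g)"
      using tw_Three by (cases g) (simp_all add: phi_def)
    then have "der Three (gn g * ?w) =
      scl (phi (gwt g) * tw Three powi wt (Word gs) + phi (wt (Word gs))) (gn g * ?w)"
      unfolding der_mult Cons sig_single
      by (simp only: single_scl[of _ "1 * _"] scl_mult_left scl_mult_right cs.scale_left_distrib)
        simp
    moreover have "phi (gwt g) * tw Three powi wt (Word gs) + phi (wt (Word gs)) =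
        phi (wt (Word (g # gs)))"
      using tw_Three
      by (simp add: phi_def wt_def power_int_add divide_simps) (simp add: algebra_simps)
    ultimately show ?case unfolding * by simp
  qed
  then have "der Three (sng w 1) = scl (phi (wt w)) (sng w 1)" for w
    by (metis word.collapse)
  then show "der Three (sng w c) = scl (phi n) (sng w c)" if "wt w = n" for w c
    using that der_scl[of Three c "sng w 1"] by (simp add: mult.commute)
qed

end

lemmas scl_norm = scl_mult_left scl_mult_right cs.scale_right_distrib
  cs.scale_right_diff_distrib algebra_simps

lemma UNIV_dir: "UNIV = {Minus, Plus, Three}"
  using dir.exhaust by auto

lemma sum_dir: "(\<Sum>i\<in>UNIV. f i) = f Minus + f Plus + (f Three :: 'a::comm_monoid_add)"
  by (simp add: UNIV_dir add.assoc)

context su11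
begin

section \<open>The defining ideal\<close>

abbreviation "I \<equiv> su_ideal q"

lemma subspace_I: "cs.subspace I"
  unfolding su_ideal_def by (rule cs.subspace_span)

lemma I_base: "r \<in> su_rels q \<union> fstar ` su_rels q \<Longrightarrow> a * r * b \<in> I"
  unfolding su_ideal_def by (rule cs.span_base) auto

lemma I_induct [consumes 1, case_names base semi additive subspace]:
  assumes "x \<in> I" "\<And>a r b. r \<in> su_rels q \<union> fstar ` su_rels q \<Longrightarrow> F (a * r * b) \<in> V"
    "\<And>c x. F (scl c x) = scl (\<theta> c) (F x)" "additive F" "cs.subspace V"
  shows "F x \<in> V"
  using assms(1) unfolding su_ideal_def
  by (rule cspan_image[OF _ _ assms(4,3,5)]) (auto intro: assms(2))

lemma I_mult_left: "x \<in> I \<Longrightarrow> y * x \<in> I"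
proof (induction rule: I_induct[where F = "\<lambda>x. y * x" and \<theta> = "\<lambda>c. c"])
  case (base a r b)
  then show ?case using I_base[of r "y * a" b] by (simp add: mult.assoc)
qed (simp_all add: scl_mult_right additive_def distrib_left subspace_I)

lemma I_mult_right: "x \<in> I \<Longrightarrow> x * y \<in> I"
proof (induction rule: I_induct[where F = "\<lambda>x. x * y" and \<theta> = "\<lambda>c. c"])
  case (base a r b)
  then show ?case using I_base[of r a "b * y"] by (simp add: mult.assoc)
qed (simp_all add: scl_mult_left additive_def distrib_right subspace_I)

lemma I_rel: "r \<in> su_rels q \<union> fstar ` su_rels q \<Longrightarrow> r \<in> I"
  using I_base[of r 1 1] by simp

lemma rels:
  "als * al - gas * ga - 1 \<in> I"
  "al * als - scl (Q^2) (ga * gas) - 1 \<in> I"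
  "ga * gas - gas * ga \<in> I"
  "scl Q (ga * al) - al * ga \<in> I"
  "scl Q (gas * al) - al * gas \<in> I"
  "scl Q (als * gas) - gas * als \<in> I"
  "scl Q (als * ga) - ga * als \<in> I"
proof -
  have "fstar (scl Q (ga * al) - al * ga) \<in> I" "fstar (scl Q (gas * al) - al * gas) \<in> I"
    by (intro I_rel; simp add: su_rels_def)+
  then show "scl Q (als * gas) - gas * als \<in> I" "scl Q (als * ga) - ga * als \<in> I"
    by (simp_all add: fstar.diff fstar_scl fstar_mult)
qed (intro I_rel; simp add: su_rels_def)+

lemma I_fstar: "x \<in> I \<Longrightarrow> fstar x \<in> I"
proof (induction rule: I_induct[where F = fstar and \<theta> = cnj])
  case (base a r b)
  then have "fstar r \<in> su_rels q \<union> fstar ` su_rels q" by auto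
  from I_base[OF this, of "fstar b" "fstar a"] show ?case by (simp add: fstar_mult mult.assoc)
qed (simp_all add: fstar_scl fstar.additive_axioms subspace_I)

text \<open>Homogeneity of the relations lets the grading, the scalings \<open>sig i\<close> and
  \<open>der Three\<close> descend to \<open>P\<close>.\<close>

lemma rels_Hom:
  assumes "r \<in> su_rels q \<union> fstar ` su_rels q"
  shows "\<exists>n. r \<in> Hom n"
proof -
  have [simp]: "gn a * gn b \<in> Hom n" if "n = gwt a + gwt b" for a b n
    unfolding that by (intro Hom_mult Hom_gn)
  \<comment> \<open>The relation between \<open>ga\<close> and \<open>al\<close> has weight 2, the
    other four have weight 0.\<close>
  have "r \<in> su_rels q \<Longrightarrow> \<exists>n. r \<in> Hom n" for r
    unfolding su_rels_def
    by (elim insertE emptyE; hypsubst)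
      ((rule exI[of _ 0], force intro!: cs.subspace_diff[OF subspace_Hom] Hom_one
          cs.subspace_scale[OF subspace_Hom])
       | (rule exI[of _ 2], force intro!: cs.subspace_diff[OF subspace_Hom]
          cs.subspace_scale[OF subspace_Hom]))+
  then show ?thesis using assms Hom_fstar by blast
qed

lemma I_sig: "x \<in> I \<Longrightarrow> sig i x \<in> I"
proof (induction rule: I_induct[where F = "sig i" and \<theta> = "\<lambda>c. c"])
  case (base a r b)
  then obtain n where "r \<in> Hom n" using rels_Hom by blast
  then show ?case
    using I_base[OF base, of "sig i a" "sig i b"]
    by (simp add: sig_mult sig_Hom scl_mult_left scl_mult_right cs.subspace_scale[OF subspace_I])
qed (simp_all add: sig_scl sig.additive_axioms subspace_I)

text \<open>By direct computation each derivative is zero or a combination of the elements in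
  \<open>rels\<close>. The adjoint relations then follow from \<open>der_fstar\<close>, and
  direction \<open>Three\<close> from homogeneity.\<close>

lemma der_rels: "r \<in> su_rels q \<Longrightarrow> der Minus r \<in> I \<and> der Plus r \<in> I"
proof -
  note I = cs.subspace_diff[OF subspace_I] cs.subspace_scale[OF subspace_I]
    cs.subspace_neg[OF subspace_I] cs.subspace_0[OF subspace_I]
  note d = der.add der.diff der_scl der_mult sig.diff
  assume "r \<in> su_rels q"
  then consider "r = als * al - gas * ga - 1" | "r = al * als - scl (Q^2) (ga * gas) - 1"
    | "r = ga * gas - gas * ga" | "r = scl Q (ga * al) - al * ga"
    | "r = scl Q (gas * al) - al * gas"
    by (auto simp: su_rels_def)
  then show ?thesis
  proof cases
    case 1
    have "der Minus r = scl (inverse (Q^2)) (scl Q (ga * al) - al * ga)"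
      unfolding 1 by (simp add: d scl_norm power2_eq_square)
    moreover have "der Plus r = scl Q (als * gas) - gas * als"
      unfolding 1 by (simp add: d scl_norm)
    ultimately show ?thesis by (simp only:) (intro conjI I rels)
  next
    case 2
    have "der Minus r = - (scl Q (ga * al) - al * ga)"
      unfolding 2 by (simp add: d scl_norm power2_eq_square)
    moreover have "der Plus r = - scl (Q^2) (scl Q (als * gas) - gas * als)"
      unfolding 2 by (simp add: d scl_norm power2_eq_square)
    ultimately show ?thesis by (simp only:) (intro conjI I rels)
  next
    case 3
    have "der Minus r = scl (inverse (Q^2)) (scl Q (ga * al) - al * ga)"
      unfolding 3 by (simp add: d scl_norm power2_eq_square)
    moreover have "der Plus r = scl Q (als * gas) - gas * als"
      unfolding 3 by (simp add: d scl_norm)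
    ultimately show ?thesis by (simp only:) (intro conjI I rels)
  next
    case 4
    have "der Minus r = 0"
      unfolding 4 by (simp add: d scl_norm)
    moreover have "der Plus r = (als * al - gas * ga - 1) - (al * als - scl (Q^2) (ga * gas) - 1)"
      unfolding 4 by (simp add: d scl_norm power2_eq_square)
    ultimately show ?thesis by (simp only:) (intro conjI I rels)
  next
    case 5
    have "der Minus r = 0" "der Plus r = 0"
      unfolding 5 by (simp_all add: d scl_norm)
    then show ?thesis using I by simp
  qed
qed

lemma der_rels_fstar: "r \<in> su_rels q \<union> fstar ` su_rels q \<Longrightarrow> der i r \<in> I"
proof (cases i)
  case Three
  assume *: "r \<in> su_rels q \<union> fstar ` su_rels q"
  then obtain n where "r \<in> Hom n" using rels_Hom by blast
  then show ?thesis
    using I_rel[OF *] by (simp add: Three der_Three_Hom cs.subspace_scale[OF subspace_I])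
qed (auto simp: der_Minus_fstar der_Plus_fstar dest: der_rels intro!: I_sig I_fstar)

text \<open>Each Leibniz term of \<open>a * r * b\<close> contains \<open>r\<close>,
  \<open>sig i r\<close> or \<open>der i r\<close>. The derivations therefore act on
  \<open>P\<close> itself.\<close>

lemma I_der: "x \<in> I \<Longrightarrow> der i x \<in> I"
proof (induction rule: I_induct[where F = "der i" and \<theta> = "\<lambda>c. c"])
  case (base a r b)
  then have "r \<in> I" "der i r \<in> I" by (auto intro: I_rel der_rels_fstar)
  then show ?case
    by (auto simp: der_mult distrib_right
        intro!: cs.subspace_add[OF subspace_I] I_sig intro: I_mult_left I_mult_right)
qed (simp_all add: der_scl der.additive_axioms subspace_I)

lemma functionals_I:
  assumes "x \<in> I"
  shows "counit x = 0 \<and> (\<forall>i. kap i x = 0 \<and> chi i x = 0)"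
proof -
  note l = counit.add counit.diff counit_scl counit.zero lfun.add lfun.diff lfun_scl lfun.zero
    counit_mult kap_mult chi_mult
  have r: "counit r = 0 \<and> (\<forall>i. kap i r = 0 \<and> chi i r = 0)"
    if "r \<in> su_rels q \<union> fstar ` su_rels q" for r
  proof -
    have "counit r = 0 \<and> kap i r = 0 \<and> chi i r = 0" for i
      using that unfolding su_rels_def
      by (cases i; auto simp: l fstar.diff fstar_scl fstar_mult power2_eq_square;
          simp add: field_simps)
    then show ?thesis by auto
  qed
  have "I \<subseteq> {x. counit x = 0 \<and> (\<forall>i. kap i x = 0 \<and> chi i x = 0)}"
    unfolding su_ideal_def
    by (rule cs.span_minimal) (use r in \<open>auto simp: l intro!: cs.subspaceI\<close>)
  with assms show ?thesis by auto
qed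

section \<open>First order forms\<close>

abbreviation "K1 \<equiv> Om1_ker q"

text \<open>These represent \<open>\<eta>\<^sub>-\<close>, \<open>\<eta>\<^sub>+\<close> and
  \<open>\<pi>(\<alpha>)\<close>; the form \<open>\<eta>\<^sub>3\<close> is \<open>1 + q^2\<close>
  times the last one.\<close>

primrec ev :: "dir \<Rightarrow> falg" where
  "ev Minus = scl Q gas"
| "ev Plus = ga"
| "ev Three = al - 1"

definition e :: "dir \<Rightarrow> falg2" where "e i = 1 \<otimes>\<^sub>c ev i"

lemma counit_ev [simp]: "counit (ev i) = 0"
  by (cases i) (simp_all add: counit.diff counit_scl)

lemma chi_ev [simp]: "chi i (ev j) = (if i = j then 1 else 0)"
  by (cases i; cases j) (simp_all add: lfun.diff lfun_scl)

lemma E_e [simp]: "E (e i) = 0" and D_e [simp]: "D i (e j) = (if i = j then 1 else 0)"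
  by (simp_all add: e_def)

lemma eta_plus_eq: "eta_plus = e Plus" and eta_minus_eq: "eta_minus q = e Minus"
  by (simp_all add: eta_plus_def eta_minus_def e_def qpi_def tens_scl_right)

section \<open>The right ideal \<open>R\<^sub>3\<close> and the right action on its quotient\<close>

lemma subspace_R3: "cs.subspace (R3 q)"
  unfolding R3_def by (rule cs.subspace_span)

lemma R3_gen: "r \<in> R3_gens q \<Longrightarrow> r * a \<in> R3 q"
  unfolding R3_def by (rule cs.span_base) auto

lemma R3_gen1: "r \<in> R3_gens q \<Longrightarrow> r \<in> R3 q"
  using R3_gen[of r 1] by simp

lemma R3_I: "x \<in> I \<Longrightarrow> x \<in> R3 q"
  unfolding R3_def by (rule cs.span_base) auto

lemma R3_mult_right: "x \<in> R3 q \<Longrightarrow> x * y \<in> R3 q"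
  unfolding R3_def
proof (rule cspan_image[of _ _ "\<lambda>x. x * y"])
  fix x assume "x \<in> {r * a | r a. r \<in> R3_gens q} \<union> I"
  then have "x * y \<in> R3 q"
    by (auto simp: mult.assoc intro: R3_gen R3_I I_mult_right)
  then show "x * y \<in> cspan ({r * a | r a. r \<in> R3_gens q} \<union> I)"
    by (simp add: R3_def)
qed (auto simp: additive_def distrib_right scl_mult_left)

text \<open>On a generator \<open>r\<close> both \<open>counit\<close> and \<open>chi i\<close>
  vanish, so the twisted Leibniz rule annihilates every \<open>r * a\<close>.\<close>

lemma functionals_R3:
  assumes "x \<in> R3 q"
  shows "counit x = 0" "chi i x = 0"
proof -
  note l = counit.add counit.diff counit_scl counit.zero lfun.add lfun.diff lfun_scl lfun.zero
    counit_mult kap_mult chi_mult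
  have r: "counit r = 0 \<and> chi i r = 0" if "r \<in> R3_gens q" for r i
    using that unfolding R3_gens_def
    by (cases i) (auto simp: l power2_eq_square)
  have "R3 q \<subseteq> {x. counit x = 0 \<and> (\<forall>i. chi i x = 0)}"
    unfolding R3_def
    by (rule cs.span_minimal) (use r functionals_I in \<open>auto simp: l intro!: cs.subspaceI\<close>)
  with assms show "counit x = 0" "chi i x = 0" by auto
qed

text \<open>This is the diagonality of the right action. For \<open>Minus\<close> and
  \<open>Plus\<close> the relations of \<open>P\<close> move \<open>al\<close> and
  \<open>als\<close> to the left, where the generators of \<open>R\<^sub>3\<close> absorb them; for
  \<open>Three\<close> the two quadratic unit relations reduce the products of \<open>al\<close> and
  \<open>als\<close>.\<close>

lemma ev_gn: "ev i * gn g - scl (kapg i g) (ev i) \<in> R3 q"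
proof -
  note R = cs.subspace_diff[OF subspace_R3] cs.subspace_scale[OF subspace_R3]
    cs.subspace_add[OF subspace_R3] cs.subspace_neg[OF subspace_R3] R3_I R3_gen1 R3_gen rels
  have G: "ga * ga \<in> R3_gens q" "gas * gas \<in> R3_gens q" "ga * gas \<in> R3_gens q"
    "al * ga - ga \<in> R3_gens q" "al * gas - gas \<in> R3_gens q"
    "als * ga - ga \<in> R3_gens q" "als * gas - gas \<in> R3_gens q"
    "scl (Q^2) al + als - scl (1 + Q^2) 1 \<in> R3_gens q"
    by (simp_all add: R3_gens_def)
  have "gas * ga = ga * gas - (ga * gas - gas * ga)" by simp
  also have "\<dots> \<in> R3 q" by (intro R G)
  finally have gg: "gas * ga \<in> R3 q" .
  show ?thesis
  proof (cases i)
    case Minus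
    have "scl Q gas * al - gas = (scl Q (gas * al) - al * gas) + (al * gas - gas)"
      by (simp add: scl_norm)
    also have "\<dots> \<in> R3 q" by (intro R G)
    finally have 1: "scl Q gas * al - gas \<in> R3 q" .
    have "scl Q gas * als - scl Q (scl Q gas) =
        scl (Q^2) (als * gas - gas) - scl Q (scl Q (als * gas) - gas * als)"
      by (simp add: scl_norm power2_eq_square)
    also have "\<dots> \<in> R3 q" by (intro R G)
    finally have 2: "scl Q gas * als - scl Q (scl Q gas) \<in> R3 q" .
    from 1 2 show ?thesis
      using gg R3_gen1[OF G(2)]
      by (cases g) (simp_all add: Minus scl_mult_left cs.subspace_scale[OF subspace_R3])
  next
    case Plus
    have "ga * al - scl (inverse Q) ga =
        scl (inverse Q) (scl Q (ga * al) - al * ga) + scl (inverse Q) (al * ga - ga)"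
      by (simp add: scl_norm)
    also have "\<dots> \<in> R3 q" by (intro R G)
    finally have 1: "ga * al - scl (inverse Q) ga \<in> R3 q" .
    have "ga * als - scl Q ga = scl Q (als * ga - ga) - (scl Q (als * ga) - ga * als)"
      by (simp add: scl_norm)
    also have "\<dots> \<in> R3 q" by (intro R G)
    finally have 2: "ga * als - scl Q ga \<in> R3 q" .
    from 1 2 show ?thesis
      using R3_gen1[OF G(1)] R3_gen1[OF G(3)] by (cases g) (simp_all add: Plus)
  next
    case Three
    have "(al - 1) * al - scl (inverse (Q^2)) (al - 1) =
        scl (inverse (Q^2)) ((scl (Q^2) al + als - scl (1 + Q^2) 1) * al)
        - scl (inverse (Q^2)) (als * al - gas * ga - 1) - scl (inverse (Q^2)) (gas * ga)"
      by (simp add: scl_norm cs.scale_left_distrib)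
    also have "\<dots> \<in> R3 q" by (intro R G gg)
    finally have 1: "(al - 1) * al - scl (inverse (Q^2)) (al - 1) \<in> R3 q" .
    have "(al - 1) * als - scl (Q^2) (al - 1) =
        (al * als - scl (Q^2) (ga * gas) - 1) + scl (Q^2) (ga * gas)
        - (scl (Q^2) al + als - scl (1 + Q^2) 1)"
      by (simp add: scl_norm cs.scale_left_distrib)
    also have "\<dots> \<in> R3 q" by (intro R G)
    finally have 2: "(al - 1) * als - scl (Q^2) (al - 1) \<in> R3 q" .
    from 1 2 show ?thesis
      using R3_gen1[OF G(4)] R3_gen1[OF G(5)]
      by (cases g) (simp_all add: Three left_diff_distrib)
  qed
qed

lemma ev_mult: "ev i * b - scl (kap i b) (ev i) \<in> R3 q"
proof (induction b rule: falg_induct)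
  case one
  show ?case by (simp add: cs.subspace_0[OF subspace_R3])
next
  case (gen g f)
  have "ev i * (gn g * f) - scl (kap i (gn g * f)) (ev i) =
      (ev i * gn g - scl (kapg i g) (ev i)) * f + scl (kapg i g) (ev i * f - scl (kap i f) (ev i))"
    by (simp add: kap_mult scl_norm)
  also have "\<dots> \<in> R3 q"
    by (intro cs.subspace_add[OF subspace_R3] cs.subspace_scale[OF subspace_R3] R3_mult_right
        ev_gn gen)
  finally show ?case .
next
  case (add f g)
  have "ev i * (f + g) - scl (kap i (f + g)) (ev i) =
      (ev i * f - scl (kap i f) (ev i)) + (ev i * g - scl (kap i g) (ev i))"
    by (simp add: lfun.add distrib_left cs.scale_left_distrib)
  then show ?case using cs.subspace_add[OF subspace_R3 add] by simp
next
  case (scl c f)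
  have "ev i * scl c f - scl (kap i (scl c f)) (ev i) = scl c (ev i * f - scl (kap i f) (ev i))"
    by (simp add: lfun_scl scl_mult_right cs.scale_right_diff_distrib)
  then show ?case using cs.subspace_scale[OF subspace_R3 scl] by simp
qed

text \<open>With \<open>functionals_R3\<close> and \<open>chi_ev\<close> this makes the classes of
  \<open>ev i\<close> a basis of \<open>ker \<epsilon> / R\<^sub>3\<close> with dual basis
  \<open>chi i\<close>. The induction multiplies the expansion of one generator by \<open>f\<close>
  and applies the diagonal right action.\<close>

lemma R3_decomp: "v - scl (counit v) 1 - (\<Sum>i\<in>UNIV. scl (chi i v) (ev i)) \<in> R3 q"
proof (induction v rule: falg_induct)
  case one
  show ?case by (simp add: cs.subspace_0[OF subspace_R3])
next
  case (gen g f)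
  \<comment> \<open>For \<open>al\<close>, \<open>ga\<close> and \<open>gas\<close> the expansion is
    an identity; for \<open>als\<close> the remainder is the last generator of
    \<open>R\<^sub>3\<close>.\<close>
  have "als - 1 - scl (- (Q^2)) (al - 1) = scl (Q^2) al + als - scl (1 + Q^2) 1"
    by (simp add: scl_norm cs.scale_left_distrib)
  also have "\<dots> \<in> R3 q" by (intro R3_gen1) (simp add: R3_gens_def)
  finally have g: "gn g - scl (gen_counit g) 1 - (\<Sum>i\<in>UNIV. scl (chig i g) (ev i)) \<in> R3 q"
    by (cases g) (simp_all add: sum_dir cs.subspace_0[OF subspace_R3])
  have "gn g * f - scl (counit (gn g * f)) 1 - (\<Sum>i\<in>UNIV. scl (chi i (gn g * f)) (ev i)) =
      (gn g - scl (gen_counit g) 1 - (\<Sum>i\<in>UNIV. scl (chig i g) (ev i))) * f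
      + scl (gen_counit g) (f - scl (counit f) 1 - (\<Sum>i\<in>UNIV. scl (chi i f) (ev i)))
      + (\<Sum>i\<in>UNIV. scl (chig i g) (ev i * f - scl (kap i f) (ev i)))"
    by (simp add: sum_dir counit_mult chi_mult scl_norm cs.scale_left_distrib
        del: chig.simps ev.simps)
  also have "\<dots> \<in> R3 q"
    by (intro cs.subspace_add[OF subspace_R3] cs.subspace_scale[OF subspace_R3] R3_mult_right
        cs.subspace_sum[OF subspace_R3] g gen ev_mult)
  finally show ?case .
next
  case (add f g)
  show ?case
    using cs.subspace_add[OF subspace_R3 add]
    by (simp add: lfun.add counit.add cs.scale_left_distrib sum_dir algebra_simps del: ev.simps)
next
  case (scl c f)
  show ?case
    using cs.subspace_scale[OF subspace_R3 scl, of c]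
    by (simp add: lfun_scl counit_scl sum_dir scl_norm del: ev.simps)
qed

lemma falg2_decomp:
  "W - E W \<otimes>\<^sub>c 1 - (\<Sum>i\<in>UNIV. D i W \<otimes>\<^sub>c ev i) \<in> tspan UNIV (R3 q)"
proof (induction W rule: tens_induct)
  case zero
  show ?case by (simp add: E.zero D.zero tl.zero cs.subspace_0[OF subspace_tspan])
next
  case (add X Y)
  show ?case
    using cs.subspace_add[OF subspace_tspan add]
    by (simp add: E.add D.add tl.add sum_dir algebra_simps del: ev.simps)
next
  case (tens a b)
  have "a \<otimes>\<^sub>c (b - scl (counit b) 1 - (\<Sum>i\<in>UNIV. scl (chi i b) (ev i))) \<in> tspan UNIV (R3 q)"
    by (intro tspan_tens R3_decomp) simp
  then show ?case
    by (simp add: tr.diff tr.sum tens_scl_left tens_scl_right)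
qed

section \<open>Coordinate criteria for \<open>Om1\<close> and \<open>Om1_ker\<close>\<close>

lemma tmap_qpi: "tmap id qpi X = X - E X \<otimes>\<^sub>c 1"
proof -
  have "additive qpi" "\<And>c x. qpi (scl c x) = scl c (qpi x)"
    by (simp_all add: additive_def qpi_def counit.add counit_scl cs.scale_left_distrib
        cs.scale_right_diff_distrib)
  note * = tmap_tens[OF this]
  show ?thesis
  proof (induction X rule: tens_induct)
    case (tens a b)
    show ?case unfolding *
      by (simp add: qpi_def tr.diff tens_scl_left tens_scl_right)
  qed (simp_all add: tmap.zero tmap.add E.zero E.add tl.zero tl.add)
qed

lemma Om1_iff: "W \<in> Om1 \<longleftrightarrow> E W = 0"
proof
  assume "W \<in> Om1"
  then have "E W \<in> {0}"
    unfolding Om1_def tspan_def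
    by (rule cspan_image[OF _ _ E.additive_axioms E_scl]) (auto simp: counit_ker_def)
  then show "E W = 0" by simp
next
  have "X - E X \<otimes>\<^sub>c 1 \<in> Om1" for X
  proof (induction X rule: tens_induct)
    case (tens a b)
    have "a \<otimes>\<^sub>c (b - scl (counit b) 1) \<in> Om1"
      unfolding Om1_def
      by (rule tspan_tens) (simp_all add: counit_ker_def counit.diff counit_scl)
    then show ?case by (simp add: tr.diff tens_scl_left tens_scl_right)
  next
    case (add X Y)
    then have "(X - E X \<otimes>\<^sub>c 1) + (Y - E Y \<otimes>\<^sub>c 1) \<in> Om1"
      unfolding Om1_def by (rule cs.subspace_add[OF subspace_tspan])
    then show ?case by (simp add: E.add tl.add algebra_simps)
  qed (simp add: E.zero tl.zero Om1_def cs.subspace_0[OF subspace_tspan])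
  then show "E W = 0 \<Longrightarrow> W \<in> Om1" by (metis tl.zero diff_zero)
qed

text \<open>This is the freeness of \<open>\<Omega>\<^sup>1(P)\<close> as a left module: a form is
  zero exactly if its coordinates vanish in \<open>P\<close>. One direction evaluates the
  functionals, the other uses the expansion \<open>falg2_decomp\<close>.\<close>

lemma Om1_ker_iff: "W \<in> K1 \<longleftrightarrow> E W = 0 \<and> (\<forall>i. D i W \<in> I)"
proof
  assume W: "W \<in> K1"
  then have "E W \<in> {0}"
    unfolding Om1_ker_def
    by (rule tker_image[OF _ E.additive_axioms E_scl])
      (auto simp: counit_ker_def functionals_R3)
  moreover have "D i W \<in> I" for i
    using W unfolding Om1_ker_def
    by (rule tker_image[OF _ D.additive_axioms D_scl subspace_I])
      (auto simp: functionals_R3 cs.subspace_scale[OF subspace_I] cs.subspace_0[OF subspace_I])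
  ultimately show "E W = 0 \<and> (\<forall>i. D i W \<in> I)" by simp
next
  assume *: "E W = 0 \<and> (\<forall>i. D i W \<in> I)"
  have "W - E W \<otimes>\<^sub>c 1 - (\<Sum>i\<in>UNIV. D i W \<otimes>\<^sub>c ev i) \<in> K1"
    using falg2_decomp[of W] unfolding Om1_ker_def tker_def
    by (intro cs.span_base) simp
  moreover have "(\<Sum>i\<in>UNIV. D i W \<otimes>\<^sub>c ev i) \<in> K1"
    unfolding Om1_ker_def
    by (intro cs.subspace_sum[OF subspace_tker] tker_left) (use * in \<open>auto simp: counit_ker_def\<close>)
  ultimately have "W - E W \<otimes>\<^sub>c 1 - (\<Sum>i\<in>UNIV. D i W \<otimes>\<^sub>c ev i)
      + (\<Sum>i\<in>UNIV. D i W \<otimes>\<^sub>c ev i) \<in> K1"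
    unfolding Om1_ker_def by (rule cs.subspace_add[OF subspace_tker])
  then show "W \<in> K1" using * by (simp add: tl.zero)
qed

lemma subspace_K1: "cs.subspace K1"
  unfolding Om1_ker_def by (rule subspace_tker)

lemma d0_eq: "d0 q p = Delta q p - p \<otimes>\<^sub>c 1"
  by (simp add: d0_def tmap_qpi)

lemma E_d0 [simp]: "E (d0 q p) = 0" and D_d0 [simp]: "D i (d0 q p) = der i p"
  by (simp_all add: d0_eq E.diff D.diff der_def)

lemma additive_d0: "additive (d0 q)"
  by (simp add: additive_def d0_eq Delta.add tl.add)

lemma lmul1_tens: "lmul1 p (a \<otimes>\<^sub>c b) = (p * a) \<otimes>\<^sub>c b"
  by (simp add: lmul1_def tens_mult)

lemma E_lmul1 [simp]: "E (lmul1 p W) = p * E W"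
  and D_lmul1 [simp]: "D i (lmul1 p W) = p * D i W"
  by (simp_all add: lmul1_def E_mult D_mult)

end

lemma additive_sum_list: "additive F \<Longrightarrow> F (\<Sum>x\<leftarrow>xs. f x) = (\<Sum>x\<leftarrow>xs. F (f x))"
  by (induction xs) (simp_all add: additive.zero additive.add)

lemma subspace_sum_list:
  "cs.subspace V \<Longrightarrow> (\<And>x. x \<in> set xs \<Longrightarrow> f x \<in> V) \<Longrightarrow> (\<Sum>x\<leftarrow>xs. f x) \<in> V"
  by (induction xs) (simp_all add: cs.subspace_0 cs.subspace_add)

lemma sum_list_diff: "(\<Sum>x\<leftarrow>xs. f x - g x) = (\<Sum>x\<leftarrow>xs. f x) - (\<Sum>x\<leftarrow>xs. g x :: 'a::ab_group_add)"
  by (induction xs) simp_all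

lemma sum_list_sum: "(\<Sum>x\<leftarrow>xs. \<Sum>i\<in>A. f x i) = (\<Sum>i\<in>A. \<Sum>x\<leftarrow>xs. f x i :: 'a::ab_group_add)"
  by (induction xs) (simp_all add: sum.distrib)

context su11
begin

section \<open>Second order forms\<close>

abbreviation "K2 \<equiv> Om2_ker q"

definition ee :: "dir \<Rightarrow> dir \<Rightarrow> falg4" where "ee i j = e i \<otimes>\<^sub>c e j"

lemma e_Om1 [simp]: "e i \<in> Om1"
  by (simp add: Om1_iff)

lemma lmul2_tens: "lmul2 p (X \<otimes>\<^sub>c Y) = lmul1 p X \<otimes>\<^sub>c Y"
  by (simp add: lmul2_def lmul1_def tens_mult)

lemma lmul2_add: "lmul2 (a + b) T = lmul2 a T + lmul2 b T"
  and lmul2_diff: "lmul2 (a - b) T = lmul2 a T - lmul2 b T"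
  and lmul2_scl: "lmul2 (scl c a) T = scl c (lmul2 a T)"
  and lmul2_one [simp]: "lmul2 1 T = T"
  by (simp_all add: lmul2_def tl.add tl.diff tens_scl_left distrib_right left_diff_distrib
      scl_mult_left tens_one)

lemma additive_lmul2: "additive (lmul2 a)"
  by (simp add: lmul2_def additive_def distrib_left)

lemma additive_lmul2_left: "additive (\<lambda>a. lmul2 a T)"
  by (simp add: additive_def lmul2_add)

lemma lmul2_scl_right: "lmul2 a (scl c T) = scl c (lmul2 a T)"
  by (simp add: lmul2_def scl_mult_right)

lemma lmul2_lmul2: "lmul2 a (lmul2 b T) = lmul2 (a * b) T"
  by (simp add: lmul2_def tens_mult flip: mult.assoc)

lemma rmul1_lmul1: "rmul1 q (lmul1 a W) p = lmul1 a (rmul1 q W p)"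
  by (simp add: rmul1_def lmul1_def mult.assoc)

lemma D_rmul1: "D i (rmul1 q W p) = D i W * sig i p + E W * der i p"
  by (simp add: rmul1_def D_rmul)

lemma E_rmul1: "E (rmul1 q W p) = E W * p"
  by (simp add: rmul1_def E_mult)

lemma K1_cong:
  "E W = E W' \<Longrightarrow> (\<And>i. D i W - D i W' \<in> I) \<Longrightarrow> W - W' \<in> K1"
  by (simp add: Om1_ker_iff E.diff D.diff)

lemma I_refl: "x - x \<in> I"
  by (simp add: cs.subspace_0[OF subspace_I])

lemma subspace_K2: "cs.subspace K2"
  unfolding Om2_ker_def by (rule cs.subspace_span)

lemma K2_left: "X \<in> K1 \<Longrightarrow> Y \<in> Om1 \<Longrightarrow> X \<otimes>\<^sub>c Y \<in> K2"
  unfolding Om2_ker_def by (intro cs.span_base UnI1 tker_left)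

lemma K2_right: "X \<in> Om1 \<Longrightarrow> Y \<in> K1 \<Longrightarrow> X \<otimes>\<^sub>c Y \<in> K2"
  unfolding Om2_ker_def by (intro cs.span_base UnI1 tker_right)

lemma K2_balance: "X \<in> Om1 \<Longrightarrow> Y \<in> Om1 \<Longrightarrow> rmul1 q X p \<otimes>\<^sub>c Y - X \<otimes>\<^sub>c lmul1 p Y \<in> K2"
  unfolding Om2_ker_def by (intro cs.span_base UnI1 UnI2) (auto simp: balance_def)

lemma K2_env: "t \<in> env_gens q \<Longrightarrow> rmul2 q (lmul2 a t) b \<in> K2"
  unfolding Om2_ker_def by (intro cs.span_base UnI2) auto

lemma rmul2_one [simp]: "rmul2 q T 1 = T"
  by (simp add: rmul2_def tens_one)

text \<open>\<open>Om2_ker\<close> is defined as a linear span only, so stability under left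
  multiplication is checked on its three kinds of generators.\<close>

lemma K2_lmul2: "T \<in> K2 \<Longrightarrow> lmul2 x T \<in> K2"
proof -
  assume "T \<in> K2"
  then have "T \<in> cspan (tker Om1 K1 Om1 K1 \<union> balance q \<union>
      {rmul2 q (lmul2 a t) b | a t b. t \<in> env_gens q})"
    by (simp add: Om2_ker_def)
  then show ?thesis
  proof (rule cspan_image[OF _ _ additive_lmul2 lmul2_scl_right subspace_K2])
    fix T assume "T \<in> tker Om1 K1 Om1 K1 \<union> balance q \<union>
      {rmul2 q (lmul2 a t) b | a t b. t \<in> env_gens q}"
    then consider "T \<in> tker Om1 K1 Om1 K1" | "T \<in> balance q"
      | a t b where "T = rmul2 q (lmul2 a t) b" "t \<in> env_gens q" by auto
    then show "lmul2 x T \<in> K2"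
    proof cases
      case 1
      then show ?thesis
      proof (rule tker_image[OF _ additive_lmul2 lmul2_scl_right subspace_K2])
        show "lmul2 x (a \<otimes>\<^sub>c b) \<in> K2" if "a \<in> K1" "b \<in> Om1" for a b
          unfolding lmul2_tens using that
          by (intro K2_left) (auto simp: Om1_ker_iff intro: I_mult_left)
        show "lmul2 x (a \<otimes>\<^sub>c b) \<in> K2" if "a \<in> Om1" "b \<in> K1" for a b
          unfolding lmul2_tens using that by (intro K2_right) (auto simp: Om1_iff)
      qed
    next
      case 2
      then obtain X p Y where T: "T = rmul1 q X p \<otimes>\<^sub>c Y - X \<otimes>\<^sub>c lmul1 p Y"
        and "X \<in> Om1" "Y \<in> Om1" by (auto simp: balance_def)
      then have "rmul1 q (lmul1 x X) p \<otimes>\<^sub>c Y - lmul1 x X \<otimes>\<^sub>c lmul1 p Y \<in> K2"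
        by (intro K2_balance) (auto simp: Om1_iff)
      then show ?thesis
        by (simp add: T additive.diff[OF additive_lmul2] lmul2_tens rmul1_lmul1)
    next
      case 3
      have "lmul2 x T = rmul2 q (lmul2 (x * a) t) b"
        unfolding 3 rmul2_def lmul2_lmul2[symmetric] by (simp add: lmul2_def mult.assoc)
      then show ?thesis using K2_env[OF 3(2)] by simp
    qed
  qed
qed

lemma K2_I: "x \<in> I \<Longrightarrow> lmul2 x (ee i j) \<in> K2"
  unfolding ee_def lmul2_tens
  by (rule K2_left) (auto simp: Om1_ker_iff intro: I_mult_right cs.subspace_0[OF subspace_I])

lemma K2_trans: "X - Y \<in> K2 \<Longrightarrow> Y - Z \<in> K2 \<Longrightarrow> X - Z \<in> K2"
  using cs.subspace_add[OF subspace_K2, of "X - Y" "Y - Z"] by simp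

section \<open>Normal forms in degrees one and two\<close>

lemma Om1_decomp:
  assumes "E W = 0"
  shows "W - (\<Sum>i\<in>UNIV. lmul1 (D i W) (e i)) \<in> K1"
proof (rule K1_cong)
  fix i
  have "D i (\<Sum>j\<in>UNIV. lmul1 (D j W) (e j)) = D i W"
    by (cases i) (simp_all add: D.add sum_dir)
  then show "D i W - D i (\<Sum>j\<in>UNIV. lmul1 (D j W) (e j)) \<in> I" by (simp only: I_refl)
qed (simp add: assms E.sum)

text \<open>Expand the second factor, carry its coefficients across the tensor sign by balancing,
  then expand the first. A coefficient \<open>p\<close> that passes the basis form of direction
  \<open>i\<close> becomes \<open>sig i p\<close>.\<close>

lemma tensor_decomp:
  assumes W: "E W = 0" and W': "E W' = 0"
  shows "W \<otimes>\<^sub>c W' - (\<Sum>i\<in>UNIV. \<Sum>j\<in>UNIV. lmul2 (D i W * sig i (D j W')) (ee i j)) \<in> K2"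
proof -
  have "W \<otimes>\<^sub>c (W' - (\<Sum>j\<in>UNIV. lmul1 (D j W') (e j))) \<in> K2"
    using W by (intro K2_right Om1_decomp W') (simp add: Om1_iff)
  then have 1: "W \<otimes>\<^sub>c W' - (\<Sum>j\<in>UNIV. W \<otimes>\<^sub>c lmul1 (D j W') (e j)) \<in> K2"
    by (simp add: tr.diff tr.sum)
  have 2: "W \<otimes>\<^sub>c lmul1 p (e j) - (\<Sum>i\<in>UNIV. lmul2 (D i W * sig i p) (ee i j)) \<in> K2" for p j
  proof (rule K2_trans)
    have "rmul1 q W p \<otimes>\<^sub>c e j - W \<otimes>\<^sub>c lmul1 p (e j) \<in> K2"
      using W by (intro K2_balance) (auto simp: Om1_iff)
    then show "W \<otimes>\<^sub>c lmul1 p (e j) - rmul1 q W p \<otimes>\<^sub>c e j \<in> K2"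
      using cs.subspace_neg[OF subspace_K2] by fastforce
    have "(rmul1 q W p - (\<Sum>i\<in>UNIV. lmul1 (D i (rmul1 q W p)) (e i))) \<otimes>\<^sub>c e j \<in> K2"
      using W by (intro K2_left Om1_decomp) (simp_all add: E_rmul1)
    then show "rmul1 q W p \<otimes>\<^sub>c e j - (\<Sum>i\<in>UNIV. lmul2 (D i W * sig i p) (ee i j)) \<in> K2"
      by (simp add: tl.diff tl.sum ee_def lmul2_tens D_rmul1 W)
  qed
  have "(\<Sum>j\<in>UNIV. W \<otimes>\<^sub>c lmul1 (D j W') (e j)
      - (\<Sum>i\<in>UNIV. lmul2 (D i W * sig i (D j W')) (ee i j))) \<in> K2"
    by (intro cs.subspace_sum[OF subspace_K2] 2)
  then have "(\<Sum>j\<in>UNIV. W \<otimes>\<^sub>c lmul1 (D j W') (e j))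
      - (\<Sum>j\<in>UNIV. \<Sum>i\<in>UNIV. lmul2 (D i W * sig i (D j W')) (ee i j)) \<in> K2"
    by (simp add: sum_subtractf)
  from K2_trans[OF 1 this] show ?thesis
    by (subst sum.swap)
qed

subsection \<open>The Maurer--Cartan equation\<close>

lemma tmapr_der_tens: "tmapr (der i) (a \<otimes>\<^sub>c b) = a \<otimes>\<^sub>c der i b"
  by (rule tmapr_tens[OF der.additive_axioms der_scl])

lemma tmapr_sig_tens: "tmapr (sig i) (a \<otimes>\<^sub>c b) = a \<otimes>\<^sub>c sig i b"
  by (rule tmapr_tens[OF sig.additive_axioms sig_scl])

lemma tmapr_der_mult:
  "tmapr (der i) (X * Y) = tmapr (der i) X * tmapr (sig i) Y + X * tmapr (der i) Y"
proof (induction X rule: tens_induct)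
  case (tens a b)
  show ?case
  proof (induction Y rule: tens_induct)
    case (tens c d)
    then show ?case by (simp add: tmapr_der_tens tmapr_sig_tens tens_mult der_mult tr.add)
  qed (simp_all add: tmapr.zero tmapr.add distrib_left)
qed (simp_all add: tmapr.zero tmapr.add distrib_right)

lemma tmapr_sig_mult: "tmapr (sig i) (X * Y) = tmapr (sig i) X * tmapr (sig i) Y"
proof (induction X rule: tens_induct)
  case (tens a b)
  show ?case
  proof (induction Y rule: tens_induct)
    case (tens c d)
    then show ?case by (simp add: tmapr_sig_tens tens_mult sig_mult)
  qed (simp_all add: tmapr.zero tmapr.add distrib_left)
qed (simp_all add: tmapr.zero tmapr.add distrib_right)

lemma Delta_sig: "Delta q (sig i f) = tmapr (sig i) (Delta q f)"
proof (induction f rule: falg_induct)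
  case one
  show ?case by (simp add: tmapr_sig_tens flip: tens_one)
next
  case (gen g f)
  have "Delta q (sig i (gn g)) = tmapr (sig i) (Delta q (gn g))"
    by (cases g) (simp_all add: Delta_scl tmapr.add tmapr_scl tmapr_sig_tens tens_scl_right
        cs.scale_right_distrib mult.commute)
  then show ?case by (simp add: sig_mult Delta_mult tmapr_sig_mult gen)
qed (simp_all add: sig.add sig_scl Delta.add Delta_scl tmapr.add tmapr_scl)

text \<open>Coassociativity as seen by the functional \<open>chi i\<close>, that is, left covariance
  of the derivation. Both sides obey the same twisted Leibniz rule, so the generators
  suffice.\<close>

lemma Delta_der: "Delta q (der i f) = tmapr (der i) (Delta q f)"
proof (induction f rule: falg_induct)
  case one
  show ?case by (simp add: tmapr_der_tens tr.zero Delta.zero flip: tens_one)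
next
  case (gen g f)
  have "Delta q (der i (gn g)) = tmapr (der i) (Delta q (gn g))"
    by (cases i; cases g) (simp_all add: Delta_scl Delta.zero tmapr.add tmapr_scl tmapr_der_tens
        tens_scl_right cs.scale_right_distrib mult_ac tr.zero tens_scl_left
        tr.minus Delta.minus add_ac)
  then show ?case
    by (simp add: der_mult Delta.add Delta_mult tmapr_der_mult Delta_sig gen)
qed (simp_all add: der.add der_scl Delta.add Delta_scl tmapr.add tmapr_scl)

text \<open>Only the first leg is taken modulo the ideal; the second stays in the free algebra,
  where all functionals and derivations still apply.\<close>

abbreviation "J \<equiv> tspan I (UNIV :: falg set)"

lemma J_induct:
  assumes "Z \<in> J" "\<And>a b. a \<in> I \<Longrightarrow> F (a \<otimes>\<^sub>c b) \<in> V" "additive F"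
    "\<And>c x. F (scl c x) = scl c (F x)" "cs.subspace V"
  shows "F Z \<in> V"
  using assms(1) unfolding tspan_def
  by (rule cspan_image[OF _ _ assms(3-5)]) (auto intro: assms(2))

lemma J_mult_left: "Z \<in> J \<Longrightarrow> X * Z \<in> J"
proof (induction X rule: tens_induct)
  case (tens c d)
  then show ?case
    by (rule J_induct[where F = "\<lambda>Z. (c \<otimes>\<^sub>c d) * Z"])
      (auto simp: tens_mult additive_def distrib_left scl_mult_right subspace_tspan
        intro!: tspan_tens I_mult_left)
qed (auto simp: distrib_right cs.subspace_0[OF subspace_tspan]
    intro: cs.subspace_add[OF subspace_tspan])

lemma J_mult_right: "Z \<in> J \<Longrightarrow> Z * X \<in> J"
proof (induction X rule: tens_induct)
  case (tens c d)
  then show ?case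
    by (rule J_induct[where F = "\<lambda>Z. Z * (c \<otimes>\<^sub>c d)"])
      (auto simp: tens_mult additive_def distrib_right scl_mult_left subspace_tspan
        intro!: tspan_tens I_mult_right)
qed (auto simp: distrib_left cs.subspace_0[OF subspace_tspan]
    intro: cs.subspace_add[OF subspace_tspan])

lemma J_D: "Z \<in> J \<Longrightarrow> D i Z \<in> I"
  by (rule J_induct[OF _ _ D.additive_axioms D_scl subspace_I])
    (auto intro: cs.subspace_scale[OF subspace_I])

lemma J_tmapr_der: "Z \<in> J \<Longrightarrow> tmapr (der i) Z \<in> J"
  by (rule J_induct[OF _ _ tmapr.additive_axioms tmapr_scl subspace_tspan])
    (auto simp: tmapr_der_tens intro: tspan_tens)

text \<open>For \<open>x = 1\<close> such a list is a representative of \<open>S(v\<^sub>(\<^sub>1\<^sub>)) \<otimes> v\<^sub>(\<^sub>2\<^sub>)\<close>.\<close>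

definition primitives :: "(falg \<times> falg) list \<Rightarrow> falg \<Rightarrow> falg \<Rightarrow> bool" where
  "primitives ghs x v \<longleftrightarrow> (\<Sum>(g, h)\<leftarrow>ghs. lmul1 g (Delta q h)) - x \<otimes>\<^sub>c v \<in> J"

lemma primitives_left:
  assumes "primitives ghs x v"
  shows "primitives (map (\<lambda>(g, h). (y * g, h)) ghs) (y * x) v"
proof -
  have "(\<Sum>(g, h)\<leftarrow>map (\<lambda>(g, h). (y * g, h)) ghs. lmul1 g (Delta q h)) =
      lmul1 y (\<Sum>(g, h)\<leftarrow>ghs. lmul1 g (Delta q h))"
    by (induction ghs) (auto simp: lmul1_def distrib_left tens_mult simp flip: mult.assoc)
  then have "(\<Sum>(g, h)\<leftarrow>map (\<lambda>(g, h). (y * g, h)) ghs. lmul1 g (Delta q h)) - (y * x) \<otimes>\<^sub>c v =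
      (y \<otimes>\<^sub>c 1) * ((\<Sum>(g, h)\<leftarrow>ghs. lmul1 g (Delta q h)) - x \<otimes>\<^sub>c v)"
    by (simp add: lmul1_def right_diff_distrib tens_mult)
  with assms show ?thesis unfolding primitives_def by (simp add: J_mult_left)
qed

text \<open>Each list arises from the coproduct of the generator by applying the antipode to the
  first leg; the antipode axiom then holds modulo the defining relations.\<close>

lemma primitives_gn: "\<exists>ghs. primitives ghs 1 (gn g)"
proof -
  note J = cs.subspace_add[OF subspace_tspan] cs.subspace_diff[OF subspace_tspan]
    cs.subspace_scale[OF subspace_tspan] tspan_tens rels UNIV_I
  note n = primitives_def lmul1_def tens_mult tens_scl_left tens_scl_right tl.add tl.diff scl_norm
  show ?thesis
  proof (cases g)
    case Al
    let ?l = "[(als, al), (- gas, ga)]"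
    have "(\<Sum>(g, h)\<leftarrow>?l. lmul1 g (Delta q h)) - 1 \<otimes>\<^sub>c al =
      (als * al - gas * ga - 1) \<otimes>\<^sub>c al + (scl Q (als * gas) - gas * als) \<otimes>\<^sub>c ga"
      by (simp add: n tl.minus)
    also have "\<dots> \<in> J" by (intro J)
    finally show ?thesis unfolding Al primitives_def by blast
  next
    case AlS
    let ?l = "[(al, als), (scl (- (Q^2)) ga, gas)]"
    have "(\<Sum>(g, h)\<leftarrow>?l. lmul1 g (Delta q h)) - 1 \<otimes>\<^sub>c als =
      (al * als - scl (Q^2) (ga * gas) - 1) \<otimes>\<^sub>c als - scl Q ((scl Q (ga * al) - al * ga) \<otimes>\<^sub>c gas)"
      by (simp add: n tl.minus power2_eq_square)
    also have "\<dots> \<in> J" by (intro J)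
    finally show ?thesis unfolding AlS primitives_def by blast
  next
    case Ga
    let ?l = "[(scl (- Q) ga, al), (al, ga)]"
    have "(\<Sum>(g, h)\<leftarrow>?l. lmul1 g (Delta q h)) - 1 \<otimes>\<^sub>c ga =
      (al * als - scl (Q^2) (ga * gas) - 1) \<otimes>\<^sub>c ga - (scl Q (ga * al) - al * ga) \<otimes>\<^sub>c al"
      by (simp add: n tl.minus power2_eq_square)
    also have "\<dots> \<in> J" by (intro J)
    finally show ?thesis unfolding Ga primitives_def by blast
  next
    case GaS
    let ?l = "[(scl (- inverse Q) gas, als), (als, gas)]"
    have "(\<Sum>(g, h)\<leftarrow>?l. lmul1 g (Delta q h)) - 1 \<otimes>\<^sub>c gas =
      (als * al - gas * ga - 1) \<otimes>\<^sub>c gas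
      + scl (inverse Q) ((scl Q (als * gas) - gas * als) \<otimes>\<^sub>c als)"
      by (simp add: n tl.minus)
    also have "\<dots> \<in> J" by (intro J)
    finally show ?thesis unfolding GaS primitives_def by blast
  qed
qed

text \<open>The antipode reverses products, so the first legs \<open>a\<close> belonging to
  \<open>w\<close> stand to the left of the first legs \<open>c\<close> belonging to
  \<open>v\<close>.\<close>

lemma primitives_mult:
  assumes "primitives ghs 1 v" "primitives ghs' 1 w"
  shows "\<exists>ghs''. primitives ghs'' 1 (v * w)"
proof -
  define Y where "Y = (\<Sum>(g, h)\<leftarrow>ghs. lmul1 g (Delta q h))"
  have *: "(\<Sum>(g, h)\<leftarrow>map (\<lambda>(c, k). (a * c, k * b)) ghs. lmul1 g (Delta q h)) =
      (a \<otimes>\<^sub>c 1) * Y * Delta q b" for a b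
    unfolding Y_def
    by (induction ghs) (auto simp: lmul1_def algebra_simps tens_mult Delta_mult
        simp flip: mult.assoc)
  define ghs'' where "ghs'' = concat (map (\<lambda>(a, b). map (\<lambda>(c, k). (a * c, k * b)) ghs) ghs')"
  have "(\<Sum>(g, h)\<leftarrow>ghs''. lmul1 g (Delta q h)) =
      (\<Sum>(a, b)\<leftarrow>ghs'. (a \<otimes>\<^sub>c 1) * Y * Delta q b)"
    unfolding ghs''_def by (induction ghs') (auto simp: * simp del: map_map)
  \<comment> \<open>The inner sum \<open>Y\<close> may be replaced by \<open>1 \<otimes> v\<close>
    because \<open>J\<close> is a two-sided ideal; that element then commutes with
    \<open>a \<otimes> 1\<close> and moves to the front.\<close>
  also have "\<dots> - (\<Sum>(a, b)\<leftarrow>ghs'. (1 \<otimes>\<^sub>c v) * lmul1 a (Delta q b)) =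
      (\<Sum>(a, b)\<leftarrow>ghs'. (a \<otimes>\<^sub>c 1) * (Y - 1 \<otimes>\<^sub>c v) * Delta q b)"
    unfolding sum_list_diff[symmetric]
    by (intro arg_cong[where f = sum_list] map_cong)
      (auto simp: lmul1_def algebra_simps tens_mult simp flip: mult.assoc)
  also have "\<dots> \<in> J"
    using assms(1) unfolding primitives_def Y_def[symmetric]
    by (intro subspace_sum_list[OF subspace_tspan]) (auto intro: J_mult_right[OF J_mult_left])
  finally have "(\<Sum>(g, h)\<leftarrow>ghs''. lmul1 g (Delta q h))
      - (\<Sum>(a, b)\<leftarrow>ghs'. (1 \<otimes>\<^sub>c v) * lmul1 a (Delta q b)) \<in> J" .
  moreover have "(\<Sum>(a, b)\<leftarrow>ghs'. (1 \<otimes>\<^sub>c v) * lmul1 a (Delta q b)) =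
      (1 \<otimes>\<^sub>c v) * (\<Sum>(a, b)\<leftarrow>ghs'. lmul1 a (Delta q b))"
    by (induction ghs') (auto simp: distrib_left)
  ultimately have 1: "(\<Sum>(g, h)\<leftarrow>ghs''. lmul1 g (Delta q h))
      - (1 \<otimes>\<^sub>c v) * (\<Sum>(a, b)\<leftarrow>ghs'. lmul1 a (Delta q b)) \<in> J" by simp
  have "(1 \<otimes>\<^sub>c v) * ((\<Sum>(a, b)\<leftarrow>ghs'. lmul1 a (Delta q b)) - 1 \<otimes>\<^sub>c w) \<in> J"
    using assms(2) unfolding primitives_def by (rule J_mult_left)
  from cs.subspace_add[OF subspace_tspan 1 this] have "primitives ghs'' 1 (v * w)"
    by (simp add: primitives_def right_diff_distrib tens_mult)
  then show ?thesis by blast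
qed

lemma ex_primitives: "\<exists>ghs. primitives ghs 1 v"
proof (induction v rule: falg_induct)
  case one
  have "primitives [(1, 1)] 1 1"
    by (simp add: primitives_def lmul1_def tens_one cs.subspace_0[OF subspace_tspan])
  then show ?case by blast
next
  case (gen g f)
  then show ?case using primitives_gn primitives_mult by blast
next
  case (add f g)
  then obtain l l' where "primitives l 1 f" "primitives l' 1 g" by blast
  then have "primitives (l @ l') 1 (f + g)"
    using cs.subspace_add[OF subspace_tspan] unfolding primitives_def
    by (fastforce simp: tr.add algebra_simps)
  then show ?case by blast
next
  case (scl c f)
  then obtain l where "primitives l 1 f" by blast
  note primitives_left[OF this, of "scl c 1"]
  moreover have "primitives l' (scl c 1 * 1) f = primitives l' 1 (scl c f)" for l'
    by (simp add: primitives_def tens_scl_left tens_scl_right)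
  ultimately show ?case by auto
qed

text \<open>Such a list presents \<open>x \<pi>(v)\<close> as a sum of terms \<open>g dh\<close>,
  the format in which the differential of degree one is defined.\<close>

lemma primitives_first_order:
  assumes "primitives ghs x v"
  shows "(\<Sum>(g, h)\<leftarrow>ghs. lmul1 g (d0 q h)) - (\<Sum>j\<in>UNIV. lmul1 (scl (chi j v) x) (e j)) \<in> K1"
proof (rule K1_cong)
  have "E (\<Sum>(g, h)\<leftarrow>ghs. lmul1 g (d0 q h)) = 0"
    by (induction ghs) (auto simp: E.zero E.add)
  then show "E (\<Sum>(g, h)\<leftarrow>ghs. lmul1 g (d0 q h)) = E (\<Sum>j\<in>UNIV. lmul1 (scl (chi j v) x) (e j))"
    by (simp add: E.sum)
next
  fix i
  have "D i (\<Sum>j\<in>UNIV. lmul1 (scl (chi j v) x) (e j)) = D i (x \<otimes>\<^sub>c v)"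
    by (cases i) (simp_all add: D.add sum_dir)
  moreover have "D i (\<Sum>(g, h)\<leftarrow>ghs. lmul1 g (d0 q h)) = D i (\<Sum>(g, h)\<leftarrow>ghs. lmul1 g (Delta q h))"
    by (induction ghs) (auto simp: D.zero D.add der_def)
  ultimately show "D i (\<Sum>(g, h)\<leftarrow>ghs. lmul1 g (d0 q h))
      - D i (\<Sum>j\<in>UNIV. lmul1 (scl (chi j v) x) (e j)) \<in> I"
    using J_D[OF assms[unfolded primitives_def], of i] by (simp only: D.diff)
qed

text \<open>The Leibniz rule for \<open>x \<pi>(v)\<close> together with the Maurer-Cartan formula:
  \<open>d \<pi>(v)\<close> is minus the product of \<open>\<pi>\<close> of the two legs of the
  coproduct of \<open>v\<close>, and \<open>chi i (der j v)\<close> is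
  \<open>chi i \<otimes> chi j\<close> evaluated on that coproduct.\<close>

lemma primitives_second_order:
  assumes "primitives ghs x v"
  shows "(\<Sum>(g, h)\<leftarrow>ghs. d0 q g \<otimes>\<^sub>c d0 q h)
    - (\<Sum>i\<in>UNIV. \<Sum>j\<in>UNIV. lmul2 (scl (chi j v) (der i x) - scl (chi i (der j v)) x) (ee i j)) \<in> K2"
proof -
  define Z where "Z = (\<Sum>(g, h)\<leftarrow>ghs. lmul1 g (Delta q h))"
  have Z: "Z - x \<otimes>\<^sub>c v \<in> J" using assms by (simp add: Z_def primitives_def)
  define C where "C i j = (\<Sum>(g, h)\<leftarrow>ghs. der i g * sig i (der j h))" for i j
  \<comment> \<open>By the Leibniz rule \<open>der i g * sig i (der j h)\<close> is
    \<open>der i (g * der j h) - g * der i (der j h)\<close>. So \<open>C i j\<close> depends on the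
    list through \<open>Z\<close> only, and modulo the ideal through \<open>x \<otimes> v\<close>
    only.\<close>
  have C: "C i j = der i (D j Z) - D i (tmapr (der j) Z)" for i j
    unfolding C_def Z_def
    by (induction ghs) (auto simp: D.add D.zero der.add der.zero tmapr.add tmapr.zero
        der_mult lmul1_def tmapr_der_mult tmapr_der_tens tr.zero D_mult simp flip: der_def Delta_der)
  have CI: "C i j - (scl (chi j v) (der i x) - scl (chi i (der j v)) x) \<in> I" for i j
  proof -
    have "der i (D j (Z - x \<otimes>\<^sub>c v)) - D i (tmapr (der j) (Z - x \<otimes>\<^sub>c v)) \<in> I"
      by (intro cs.subspace_diff[OF subspace_I] I_der J_D J_tmapr_der Z)
    then show ?thesis
      by (simp add: C D.diff der.diff tmapr.diff tmapr_der_tens der_scl algebra_simps)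
  qed
  have "(\<Sum>(g, h)\<leftarrow>ghs. d0 q g \<otimes>\<^sub>c d0 q h
      - (\<Sum>i\<in>UNIV. \<Sum>j\<in>UNIV. lmul2 (der i g * sig i (der j h)) (ee i j))) \<in> K2"
  proof (intro subspace_sum_list[OF subspace_K2], clarify)
    fix g h
    show "d0 q g \<otimes>\<^sub>c d0 q h
      - (\<Sum>i\<in>UNIV. \<Sum>j\<in>UNIV. lmul2 (der i g * sig i (der j h)) (ee i j)) \<in> K2"
      using tensor_decomp[of "d0 q g" "d0 q h"] by simp
  qed
  also have "(\<Sum>(g, h)\<leftarrow>ghs. d0 q g \<otimes>\<^sub>c d0 q h
      - (\<Sum>i\<in>UNIV. \<Sum>j\<in>UNIV. lmul2 (der i g * sig i (der j h)) (ee i j))) =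
      (\<Sum>(g, h)\<leftarrow>ghs. d0 q g \<otimes>\<^sub>c d0 q h) - (\<Sum>i\<in>UNIV. \<Sum>j\<in>UNIV. lmul2 (C i j) (ee i j))"
    unfolding C_def
    by (simp add: case_prod_unfold sum_list_diff sum_list_sum
        additive_sum_list[OF additive_lmul2_left])
  finally have 1: "(\<Sum>(g, h)\<leftarrow>ghs. d0 q g \<otimes>\<^sub>c d0 q h)
      - (\<Sum>i\<in>UNIV. \<Sum>j\<in>UNIV. lmul2 (C i j) (ee i j)) \<in> K2" .
  have "(\<Sum>i\<in>UNIV. \<Sum>j\<in>UNIV.
      lmul2 (C i j - (scl (chi j v) (der i x) - scl (chi i (der j v)) x)) (ee i j)) \<in> K2"
    by (intro cs.subspace_sum[OF subspace_K2] K2_I CI)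
  then have "(\<Sum>i\<in>UNIV. \<Sum>j\<in>UNIV. lmul2 (C i j) (ee i j)) - (\<Sum>i\<in>UNIV. \<Sum>j\<in>UNIV.
      lmul2 (scl (chi j v) (der i x) - scl (chi i (der j v)) x) (ee i j)) \<in> K2"
    by (subst (asm) lmul2_diff) (simp only: sum_subtractf)
  from K2_trans[OF 1 this] show ?thesis .
qed

lemma env_gens_K2:
  assumes "(\<Sum>(g, h)\<leftarrow>ghs. lmul1 g (d0 q h)) \<in> K1"
  shows "(\<Sum>(g, h)\<leftarrow>ghs. d0 q g \<otimes>\<^sub>c d0 q h) \<in> K2"
proof -
  have "(\<Sum>(g, h)\<leftarrow>ghs. d0 q g \<otimes>\<^sub>c d0 q h) \<in> env_gens q"
    unfolding env_gens_def using assms by blast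
  from K2_env[OF this, of 1 1] show ?thesis by simp
qed

text \<open>For \<open>v\<close> in \<open>R\<^sub>3\<close> the one-form of its list is zero, so
  the list is an envelope relation, which the Maurer-Cartan formula turns into a quadratic relation
  between basis forms.\<close>

lemma R3_relation:
  assumes "v \<in> R3 q"
  shows "(\<Sum>i\<in>UNIV. \<Sum>j\<in>UNIV. scl (chi i (der j v)) (ee i j)) \<in> K2"
proof -
  obtain ghs where ghs: "primitives ghs 1 v" using ex_primitives by blast
  have "(\<Sum>(g, h)\<leftarrow>ghs. lmul1 g (d0 q h)) \<in> K1"
    using primitives_first_order[OF ghs] functionals_R3[OF assms]
    by (simp add: lmul1_def tl.zero)
  from cs.subspace_diff[OF subspace_K2 env_gens_K2[OF this] primitives_second_order[OF ghs]]
  have "(\<Sum>i\<in>UNIV. \<Sum>j\<in>UNIV. lmul2 (- scl (chi i (der j v)) 1) (ee i j)) \<in> K2"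
    by simp
  then have "(\<Sum>i\<in>UNIV. \<Sum>j\<in>UNIV. - scl (chi i (der j v)) (ee i j)) \<in> K2"
    by (simp add: lmul2_scl additive.minus[OF additive_lmul2_left])
  from cs.subspace_neg[OF subspace_K2 this] show ?thesis
    by (simp add: sum_negf)
qed

section \<open>Quadratic relations between the basis forms\<close>

lemma K2_scl_cancel: "scl c T \<in> K2 \<Longrightarrow> c \<noteq> 0 \<Longrightarrow> T \<in> K2"
  using cs.subspace_scale[OF subspace_K2, of "scl c T" "inverse c"] by simp

text \<open>These are \<open>R3_relation\<close> for the generators \<open>ga * ga\<close>,
  \<open>gas * gas\<close>, \<open>ga * gas\<close>, \<open>al * gas - gas\<close> and
  \<open>als * ga - ga\<close>, each up to a nonzero factor.\<close>

lemma ee_relations: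
  "ee Plus Plus \<in> K2" "ee Minus Minus \<in> K2"
  "ee Plus Minus + scl (Q^2) (ee Minus Plus) \<in> K2"
  "ee Three Minus + scl (Q^4) (ee Minus Three) \<in> K2"
  "scl (Q^4) (ee Three Plus) + ee Plus Three \<in> K2"
proof -
  note s = R3_gens_def sum_dir der_mult der_scl der.add der.diff der.zero chi_mult kap_mult
    counit_mult lfun.add lfun.diff lfun.minus lfun_scl lfun.zero counit.add counit.diff
    counit.minus counit_scl counit.zero
  note R = R3_relation[OF R3_gen1]
  \<comment> \<open>The squares of the basis forms appear with a multiple of \<open>1 + q^2\<close>,
    which is nonzero because \<open>q\<close> is real.\<close>
  have "1 + q^2 \<noteq> 0"
    by (smt (verit) zero_le_power2)
  then have "complex_of_real (1 + q^2) \<noteq> 0"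
    by (simp only: of_real_eq_0_iff not_False_eq_True)
  then have n: "1 + Q^2 \<noteq> 0" by simp
  have "scl (inverse Q * (1 + Q^2)) (ee Plus Plus) \<in> K2"
    using R[of "ga * ga"] by (simp add: s power2_eq_square algebra_simps)
  then show "ee Plus Plus \<in> K2" by (rule K2_scl_cancel) (simp add: n)
  have "scl (inverse Q + inverse Q * (inverse Q * inverse Q)) (ee Minus Minus) \<in> K2"
    using R[of "gas * gas"] by (simp add: s)
  then show "ee Minus Minus \<in> K2"
    by (rule K2_scl_cancel) (use n in \<open>simp add: field_simps power2_eq_square\<close>)
  have "ee Minus Plus + scl (inverse Q * inverse Q) (ee Plus Minus) \<in> K2"
    using R[of "ga * gas"] by (simp add: s)
  moreover have "Q^2 * (inverse Q * inverse Q) = 1"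
    by (simp add: field_simps power2_eq_square)
  ultimately
  show "ee Plus Minus + scl (Q^2) (ee Minus Plus) \<in> K2"
    using cs.subspace_scale[OF subspace_K2, of "ee Minus Plus + _" "Q^2"]
    by (fastforce simp: cs.scale_right_distrib add.commute)
  have "scl (Q^2 * inverse Q) (ee Minus Three)
      + scl (inverse Q * inverse (Q^2)) (ee Three Minus) \<in> K2"
    using R[of "al * gas - gas"] by (simp add: s)
  moreover have "Q^3 * (Q^2 * inverse Q) = Q^4" "Q^3 * (inverse Q * inverse (Q^2)) = 1"
    by (simp_all add: field_simps power2_eq_square power3_eq_cube power4_eq_xxxx)
  ultimately
  show "ee Three Minus + scl (Q^4) (ee Minus Three) \<in> K2"
    using cs.subspace_scale[OF subspace_K2, of "scl (Q^2 * inverse Q) (ee Minus Three) + _" "Q^3"]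
    by (fastforce simp: cs.scale_right_distrib add.commute)
  have "- ee Plus Three - scl (Q ^ 4) (ee Three Plus) \<in> K2"
    using R[of "als * ga - ga"] by (simp add: s)
  from cs.subspace_neg[OF subspace_K2 this]
  show "scl (Q^4) (ee Three Plus) + ee Plus Three \<in> K2" by simp
qed

section \<open>The differential of base one-forms\<close>

lemma phi_values: "phi 0 = 0" "phi 2 = 1 + inverse (Q^2)" "phi (- 2) = - (Q^2) - Q^4"
proof -
  have t: "tw Three - 1 \<noteq> 0" using tw_Three by simp
  have "phi 2 = tw Three + 1"
    using t by (simp add: phi_def divide_simps del: tw.simps)
      (simp add: algebra_simps power2_eq_square)
  then show "phi 2 = 1 + inverse (Q^2)" by simp
  have "phi (- 2) = - (tw Three + 1) / (tw Three)^2"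
    using t by (simp add: phi_def divide_simps power_int_minus del: tw.simps)
      (simp add: algebra_simps power2_eq_square)
  also have "\<dots> = - (Q^2) - Q^4"
    by (simp add: field_simps power2_eq_square power4_eq_xxxx)
  finally show "phi (- 2) = - (Q^2) - Q^4" .
qed (simp add: phi_def)

text \<open>Weight 2 gives \<open>der Three x = scl (phi 2) x\<close>, and with this value the terms
  containing the third basis form combine into a multiple of the relation between
  \<open>ee Three Minus\<close> and \<open>ee Minus Three\<close>.\<close>

lemma form_Minus_second_order:
  assumes "primitives ghs x (ev Minus)" "x \<in> Hom 2"
  shows "(\<Sum>(g, h)\<leftarrow>ghs. d0 q g \<otimes>\<^sub>c d0 q h) - lmul2 (- scl (Q^2) (der Plus x)) (ee Minus Plus) \<in> K2"
proof -
  let ?S = "\<Sum>i\<in>UNIV. \<Sum>j\<in>UNIV.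
    lmul2 (scl (chi j (ev Minus)) (der i x) - scl (chi i (der j (ev Minus))) x) (ee i j)"
  have [simp]: "Q * (Q^2 * inverse Q) = Q^2" "Q^4 * inverse (Q^2) = Q^2"
    by (simp_all add: field_simps power2_eq_square power4_eq_xxxx)
  have "?S - lmul2 (- scl (Q^2) (der Plus x)) (ee Minus Plus) = lmul2 (der Minus x) (ee Minus Minus)
      + lmul2 (der Plus x) (ee Plus Minus + scl (Q^2) (ee Minus Plus))
      + lmul2 (scl (inverse (Q^2)) x) (ee Three Minus + scl (Q^4) (ee Minus Three))"
    by (simp add: sum_dir lfun_scl der_scl der_Three_Hom[OF assms(2)] phi_values lfun.zero
        additive.add[OF additive_lmul2] lmul2_add lmul2_diff lmul2_scl lmul2_scl_right
        additive.minus[OF additive_lmul2_left] additive.zero[OF additive_lmul2_left]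
        cs.scale_left_distrib lfun.minus)
  also have "\<dots> \<in> K2"
    by (intro cs.subspace_add[OF subspace_K2] K2_lmul2 ee_relations)
  finally show ?thesis
    by (rule K2_trans[OF primitives_second_order[OF assms(1)]])
qed

text \<open>Likewise \<open>phi (- 2)\<close> is the value for which the terms with the third basis
  form assemble into the relation between \<open>ee Three Plus\<close> and
  \<open>ee Plus Three\<close>.\<close>

lemma form_Plus_second_order:
  assumes "primitives ghs y (ev Plus)" "y \<in> Hom (- 2)"
  shows "(\<Sum>(g, h)\<leftarrow>ghs. d0 q g \<otimes>\<^sub>c d0 q h) - lmul2 (der Minus y) (ee Minus Plus) \<in> K2"
proof -
  let ?S = "\<Sum>i\<in>UNIV. \<Sum>j\<in>UNIV.
    lmul2 (scl (chi j (ev Plus)) (der i y) - scl (chi i (der j (ev Plus))) y) (ee i j)"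
  have "?S - lmul2 (der Minus y) (ee Minus Plus) = lmul2 (der Plus y) (ee Plus Plus)
      - lmul2 y (scl (Q^4) (ee Three Plus) + ee Plus Three)"
    by (simp add: sum_dir lfun_scl der_scl der_Three_Hom[OF assms(2)] phi_values lfun.zero
        additive.add[OF additive_lmul2] lmul2_add lmul2_diff lmul2_scl lmul2_scl_right
        additive.minus[OF additive_lmul2_left] additive.zero[OF additive_lmul2_left]
        cs.scale_left_diff_distrib)
  also have "\<dots> \<in> K2"
    by (intro cs.subspace_diff[OF subspace_K2] K2_lmul2 ee_relations)
  finally show ?thesis
    by (rule K2_trans[OF primitives_second_order[OF assms(1)]])
qed

text \<open>Joining one presentation of a form with the negative of another gives a list whose
  one-form is zero; its two-form is an envelope relation, so the differential is well
  defined.\<close>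

lemma d1_P_eqI:
  assumes "W = cls K1 (\<Sum>(g, h)\<leftarrow>ghs. lmul1 g (d0 q h))"
    "V = cls K2 (\<Sum>(g, h)\<leftarrow>ghs. d0 q g \<otimes>\<^sub>c d0 q h)"
  shows "d1_P q W = V"
  unfolding d1_P_def
proof (rule the_equality)
  fix V'
  assume "\<exists>ghs. W = cls K1 (\<Sum>(g, h)\<leftarrow>ghs. lmul1 g (d0 q h)) \<and>
      V' = cls K2 (\<Sum>(g, h)\<leftarrow>ghs. d0 q g \<otimes>\<^sub>c d0 q h)"
  then obtain l where l: "W = cls K1 (\<Sum>(g, h)\<leftarrow>l. lmul1 g (d0 q h))"
    "V' = cls K2 (\<Sum>(g, h)\<leftarrow>l. d0 q g \<otimes>\<^sub>c d0 q h)" by blast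
  let ?l = "l @ map (\<lambda>(g, h). (- g, h)) ghs"
  have "(\<Sum>(g, h)\<leftarrow>map (\<lambda>(g, h). (- g, h)) ghs. lmul1 g (d0 q h)) =
      - (\<Sum>(g, h)\<leftarrow>ghs. lmul1 g (d0 q h))"
    by (induction ghs) (auto simp: lmul1_def tl.minus)
  then have "(\<Sum>(g, h)\<leftarrow>?l. lmul1 g (d0 q h)) =
      (\<Sum>(g, h)\<leftarrow>l. lmul1 g (d0 q h)) - (\<Sum>(g, h)\<leftarrow>ghs. lmul1 g (d0 q h))"
    by (simp del: map_map)
  also have "\<dots> \<in> K1"
    using l(1) assms(1) cls_eq_iff[OF subspace_K1] by metis
  finally have "(\<Sum>(g, h)\<leftarrow>?l. d0 q g \<otimes>\<^sub>c d0 q h) \<in> K2" by (rule env_gens_K2)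
  moreover have "(\<Sum>(g, h)\<leftarrow>map (\<lambda>(g, h). (- g, h)) ghs. d0 q g \<otimes>\<^sub>c d0 q h) =
      - (\<Sum>(g, h)\<leftarrow>ghs. d0 q g \<otimes>\<^sub>c d0 q h)"
    by (induction ghs) (auto simp: additive.minus[OF additive_d0] tl.minus)
  ultimately have "(\<Sum>(g, h)\<leftarrow>l. d0 q g \<otimes>\<^sub>c d0 q h) - (\<Sum>(g, h)\<leftarrow>ghs. d0 q g \<otimes>\<^sub>c d0 q h) \<in> K2"
    by (simp del: map_map)
  then show "V' = V"
    by (simp add: l assms(2) cls_eq_iff[OF subspace_K2])
qed (use assms in blast)

lemma d1_P_form:
  assumes x: "x \<in> Hom 2" and y: "y \<in> Hom (- 2)"
  shows "d1_P q (cls K1 (lmul1 x (e Minus) + lmul1 y (e Plus))) =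
    cls K2 (lmul2 (der Minus y - scl (Q^2) (der Plus x)) (ee Minus Plus))"
proof -
  obtain l l' where "primitives l 1 (ev Minus)" "primitives l' 1 (ev Plus)"
    using ex_primitives by metis
  from primitives_left[OF this(1), of x] primitives_left[OF this(2), of y]
  obtain m m' where m: "primitives m x (ev Minus)" "primitives m' y (ev Plus)" by auto
  have [simp]: "lmul1 0 X = 0" for X by (simp add: lmul1_def tl.zero)
  have "(\<Sum>(g, h)\<leftarrow>m. lmul1 g (d0 q h)) - lmul1 x (e Minus) \<in> K1"
    "(\<Sum>(g, h)\<leftarrow>m'. lmul1 g (d0 q h)) - lmul1 y (e Plus) \<in> K1"
    using primitives_first_order[OF m(1)] primitives_first_order[OF m(2)]
    by (simp_all add: sum_dir del: ev.simps)
  from cs.subspace_add[OF subspace_K1 this]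
  have "(\<Sum>(g, h)\<leftarrow>m @ m'. lmul1 g (d0 q h)) - (lmul1 x (e Minus) + lmul1 y (e Plus)) \<in> K1"
    by (simp add: algebra_simps)
  then have 1: "cls K1 (lmul1 x (e Minus) + lmul1 y (e Plus)) =
      cls K1 (\<Sum>(g, h)\<leftarrow>m @ m'. lmul1 g (d0 q h))"
    by (metis cls_eq_iff[OF subspace_K1])
  have "(\<Sum>(g, h)\<leftarrow>m @ m'. d0 q g \<otimes>\<^sub>c d0 q h)
      - lmul2 (der Minus y - scl (Q^2) (der Plus x)) (ee Minus Plus) \<in> K2"
    using cs.subspace_add[OF subspace_K2 form_Minus_second_order[OF m(1) x]
        form_Plus_second_order[OF m(2) y]]
    by (simp add: lmul2_diff additive.minus[OF additive_lmul2_left] algebra_simps)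
  then have 2: "cls K2 (lmul2 (der Minus y - scl (Q^2) (der Plus x)) (ee Minus Plus)) =
      cls K2 (\<Sum>(g, h)\<leftarrow>m @ m'. d0 q g \<otimes>\<^sub>c d0 q h)"
    by (metis cls_eq_iff[OF subspace_K2])
  show ?thesis by (rule d1_P_eqI[OF 1 2])
qed

subsection \<open>The coefficient of the volume form\<close>

text \<open>The coefficient of \<open>ee Minus Plus\<close> once \<open>ee Plus Minus\<close> is
  replaced by \<open>- (Q^2)\<close> times it, all other products being dropped. The twist comes
  from moving the second coefficient to the left.\<close>

definition vol :: "falg4 \<Rightarrow> falg" where
  "vol = lin (\<lambda>(k, l). D Minus (sng k 1) * sig Minus (D Plus (sng l 1))
     - scl (Q^2) (D Plus (sng k 1) * sig Minus (D Minus (sng l 1))))"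

sublocale vol: additive vol unfolding vol_def by (rule additive_lin)

lemma vol_scl: "vol (scl c T) = scl c (vol T)"
  by (simp add: vol_def lin_scl)

lemma vol_tens: "vol (X \<otimes>\<^sub>c Y) =
    D Minus X * sig Minus (D Plus Y) - scl (Q^2) (D Plus X * sig Minus (D Minus Y))"
proof (induction X rule: free_induct)
  case (single k c)
  have c: "D i (sng k c) = scl c (D i (sng k 1))" for i k c by (simp flip: D_scl)
  show ?case
  proof (induction Y rule: free_induct)
    case (single l d)
    show ?case
      unfolding tens_single vol_def lin_single c[of _ k c] c[of _ l d] sig_scl
      by (simp add: scl_norm)
  qed (simp_all add: tr.zero tr.add vol.zero vol.add D.zero D.add sig.zero sig.add distrib_left
      cs.scale_right_distrib add_diff_add)
qed (simp_all add: tl.zero tl.add vol.zero vol.add D.zero D.add distrib_right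
    cs.scale_right_distrib add_diff_add)

lemma vol_lmul2: "vol (lmul2 a T) = a * vol T"
  by (induction T rule: tens_induct)
    (simp_all add: additive.add[OF additive_lmul2] additive.zero[OF additive_lmul2] vol.zero
      vol.add distrib_left lmul2_tens vol_tens right_diff_distrib scl_mult_right mult.assoc)

text \<open>The factor \<open>p\<close> passes two basis forms, each contributing one twist;
  \<open>E Y = 0\<close> removes the term with the derivative of \<open>p\<close>.\<close>

lemma vol_rmul2:
  assumes "E Y = 0"
  shows "vol (rmul2 q (X \<otimes>\<^sub>c Y) p) = vol (X \<otimes>\<^sub>c Y) * sig Minus (sig Minus p)"
  using assms
  by (simp add: rmul2_def tens_mult vol_tens D_rmul sig_Plus sig_mult left_diff_distrib
      scl_mult_left mult.assoc)

text \<open>The Leibniz rule writes the coefficient through derivatives of the coordinates of the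
  vanishing form \<open>\<Sum> g dh\<close>. The second derivatives of \<open>h\<close> left over
  are collected by \<open>der_commutator\<close> into its third coordinate, also in the
  ideal.\<close>

lemma vol_env:
  assumes "t \<in> env_gens q"
  shows "vol t \<in> I"
proof -
  from assms obtain ghs where t: "t = (\<Sum>(g, h)\<leftarrow>ghs. d0 q g \<otimes>\<^sub>c d0 q h)"
    and K: "(\<Sum>(g, h)\<leftarrow>ghs. lmul1 g (d0 q h)) \<in> K1"
    unfolding env_gens_def by blast
  have D: "D i (\<Sum>(g, h)\<leftarrow>ghs. lmul1 g (d0 q h)) = (\<Sum>(g, h)\<leftarrow>ghs. g * der i h)" for i
    by (induction ghs) (auto simp: D.zero D.add)
  have I: "(\<Sum>(g, h)\<leftarrow>ghs. g * der i h) \<in> I" for i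
    using K unfolding D[symmetric] Om1_ker_iff by blast
  have "vol t = der Minus (\<Sum>(g, h)\<leftarrow>ghs. g * der Plus h)
      - scl (Q^2) (der Plus (\<Sum>(g, h)\<leftarrow>ghs. g * der Minus h)) - (\<Sum>(g, h)\<leftarrow>ghs. g * der Three h)"
    unfolding t
    by (induction ghs) (auto simp: vol.zero vol.add der.zero der.add vol_tens der_mult sig_Plus
        scl_norm simp flip: der_commutator)
  also have "\<dots> \<in> I"
    by (intro cs.subspace_diff[OF subspace_I] cs.subspace_scale[OF subspace_I] I_der I)
  finally show ?thesis .
qed

lemma vol_K2:
  assumes "T \<in> K2"
  shows "vol T \<in> I"
  using assms unfolding Om2_ker_def
proof (rule cspan_image[OF _ _ vol.additive_axioms vol_scl subspace_I])
  note I = cs.subspace_diff[OF subspace_I] cs.subspace_scale[OF subspace_I]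
  fix T assume "T \<in> tker Om1 K1 Om1 K1 \<union> balance q \<union>
      {rmul2 q (lmul2 a t) b | a t b. t \<in> env_gens q}"
  then consider "T \<in> tker Om1 K1 Om1 K1" | "T \<in> balance q"
    | a t b where "T = rmul2 q (lmul2 a t) b" "t \<in> env_gens q" by auto
  then show "vol T \<in> I"
  proof cases
    case 1
    then show ?thesis
      by (rule tker_image[OF _ vol.additive_axioms vol_scl subspace_I])
        (auto simp: vol_tens Om1_ker_iff intro!: I intro: I_mult_left I_mult_right I_sig)
  next
    case 2
    then obtain X p Y where "T = rmul1 q X p \<otimes>\<^sub>c Y - X \<otimes>\<^sub>c lmul1 p Y" "X \<in> Om1" "Y \<in> Om1"
      by (auto simp: balance_def)
    then have "vol T = 0"
      by (simp add: vol.diff vol_tens D_rmul1 Om1_iff sig_mult sig_Plus mult.assoc)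
    then show ?thesis by (simp add: cs.subspace_0[OF subspace_I])
  next
    case 3
    from 3(2) obtain ghs where t: "t = (\<Sum>(g, h)\<leftarrow>ghs. d0 q g \<otimes>\<^sub>c d0 q h)"
      unfolding env_gens_def by blast
    \<comment> \<open>\<open>vol_rmul2\<close> speaks of a pure tensor with a one-form as second
      factor, so it is applied to each term \<open>dg dh\<close> separately.\<close>
    have "vol T = a * vol t * sig Minus (sig Minus b)"
      unfolding 3(1) t
    proof (induction ghs)
      case (Cons gh ghs)
      obtain g h where gh: "gh = (g, h)" by (cases gh)
      have "vol (rmul2 q (lmul2 a (d0 q g \<otimes>\<^sub>c d0 q h)) b) =
          a * vol (d0 q g \<otimes>\<^sub>c d0 q h) * sig Minus (sig Minus b)"
        unfolding lmul2_tens by (subst vol_rmul2) (simp_all add: vol_lmul2 flip: lmul2_tens)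
      with Cons show ?case
        by (simp add: gh additive.add[OF additive_lmul2] rmul2_def vol.add algebra_simps)
    qed (simp add: lmul2_def rmul2_def vol.zero)
    with vol_env[OF 3(2)] show ?thesis
      by (simp add: I_mult_left I_mult_right)
  qed
qed

text \<open>The value of \<open>vol\<close> on \<open>p dvol\<close> is \<open>p\<close>. This is
  what makes the Hodge operators on functions injective.\<close>

lemma volume_form_free: "lmul2 p (ee Minus Plus) \<in> K2 \<Longrightarrow> p \<in> I"
  using vol_K2[of "lmul2 p (ee Minus Plus)"] by (simp add: vol_lmul2 ee_def vol_tens sig.zero)

end

context su11
begin

section \<open>Homogeneous representatives\<close>

text \<open>The coaction before passing to the quotient; there every word is an exact weight vector,
  so weights are found by counting letters.\<close>

definition coact :: "falg \<Rightarrow> (word \<times> int \<Rightarrow>\<^sub>0 complex)" where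
  "coact f = tmapr proj_j (Delta q f)"

sublocale coact: additive coact
  unfolding coact_def by (rule additive_o[OF tmapr.additive_axioms Delta.additive_axioms])

lemma coact_scl: "coact (scl c f) = scl c (coact f)"
  by (simp add: coact_def Delta_scl tmapr_scl)

lemma tmapr_proj_j: "tmapr proj_j (a \<otimes>\<^sub>c b) = a \<otimes>\<^sub>c proj_j b"
  unfolding proj_j_def by (rule tmapr_tens[OF alg_ext.additive_axioms alg_ext_scl])

lemma coact_mult: "coact (a * b) = coact a * coact b"
proof -
  have "tmapr proj_j (X * Y) = tmapr proj_j X * tmapr proj_j Y" for X Y :: falg2
  proof (induction X rule: tens_induct)
    case (tens a b)
    show ?case
    proof (induction Y rule: tens_induct)
      case (tens c d)
      show ?case by (simp add: tens_mult tmapr_proj_j) (simp add: proj_j_def alg_ext_mult)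
    qed (simp_all add: tmapr.zero tmapr.add distrib_left)
  qed (simp_all add: tmapr.zero tmapr.add distrib_right)
  then show ?thesis by (simp add: coact_def Delta_mult)
qed

lemma coact_gn: "coact (gn g) = gn g \<otimes>\<^sub>c zpow (gwt g)"
proof -
  have [simp]: "proj_j (gn g) = gen_j g" for g
    by (simp add: proj_j_def alg_ext_gn)
  show ?thesis
    by (cases g) (simp_all add: coact_def tmapr.add tmapr_scl tmapr_proj_j tr.zero)
qed

lemma coact_one: "coact 1 = 1"
proof -
  have "proj_j 1 = 1" by (simp add: proj_j_def alg_ext_one)
  with tmapr_proj_j[of "1 :: falg" 1] show ?thesis by (simp only: coact_def Delta_one tens_one)
qed

lemma coact_single: "coact (sng w c) = sng (w, wt w) c"
proof -
  have "coact (sng (Word gs) 1) = sng (Word gs, wt (Word gs)) 1" for gs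
  proof (induction gs)
    case Nil
    have "sng (Word []) 1 = (1 :: falg)" by (simp flip: zero_word_def)
    moreover have "sng (Word [], wt (Word [])) 1 = (1 :: word \<times> int \<Rightarrow>\<^sub>0 complex)"
      by (simp add: wt_def flip: zero_word_def zero_prod_def)
    ultimately show ?case by (simp only: coact_one)
  next
    case (Cons g gs)
    have "sng (Word (g # gs)) 1 = gn g * (sng (Word gs) 1 :: falg)"
      by (simp add: gn_def mult_single plus_word_def)
    then show ?case
      by (simp add: coact_mult Cons coact_gn) (simp add: gn_def zpow_def mult_single plus_word_def wt_def)
  qed
  from this[of "letters w"] have "coact (sng w 1) = sng (w, wt w) 1" by simp
  then show ?thesis using coact_scl[of c "sng w 1"] by simp
qed

lemma coact_Hom: "f \<in> Hom n \<Longrightarrow> coact f = f \<otimes>\<^sub>c zpow n"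
  by (erule Hom_eqI[OF _ coact.additive_axioms tl.additive_axioms])
    (simp add: coact_single zpow_def)

section \<open>Weight spaces of \<open>P\<close> through homogeneous representatives\<close>

abbreviation "PG \<equiv> PG_ker q"

lemma subspace_PG: "cs.subspace PG"
  unfolding PG_ker_def by (rule subspace_tker)

lemma PG_tens: "a \<in> I \<Longrightarrow> a \<otimes>\<^sub>c g \<in> PG"
  unfolding PG_ker_def by (rule tker_left) auto

lemma PG_idt: "X \<in> PG \<Longrightarrow> idt \<phi> X \<in> I"
  unfolding PG_ker_def
proof (erule tker_image[OF _ idt.additive_axioms idt_scl subspace_I])
  show "idt \<phi> (a \<otimes>\<^sub>c b) \<in> I" if "b \<in> {0}" for a b
    using that by (simp add: tr.zero idt.zero cs.subspace_0[OF subspace_I])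
qed (simp add: cs.subspace_scale[OF subspace_I])

lemma PG_ideal:
  assumes "r \<in> I"
  shows "X * (r \<otimes>\<^sub>c g) * Y \<in> PG"
proof (induction X rule: tens_induct)
  case (tens a b)
  show ?case
    by (induction Y rule: tens_induct)
      (auto simp: tens_mult distrib_left cs.subspace_0[OF subspace_PG] assms
        intro!: PG_tens I_mult_right[OF I_mult_left] intro: cs.subspace_add[OF subspace_PG])
qed (auto simp: distrib_right cs.subspace_0[OF subspace_PG]
    intro: cs.subspace_add[OF subspace_PG])

lemma coact_I: "x \<in> I \<Longrightarrow> coact x \<in> PG"
proof (induction rule: I_induct[where F = coact and \<theta> = "\<lambda>c. c"])
  case (base a r b)
  then obtain n where "r \<in> Hom n" using rels_Hom by blast
  then show ?case
    using PG_ideal[OF I_rel[OF base]] by (simp add: coact_mult coact_Hom)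
qed (simp_all add: coact_scl coact.additive_axioms subspace_PG)

lemma SU11_weight_alt:
  "SU11_weight q n = {x \<in> SU11 q. coact (rep x) - rep x \<otimes>\<^sub>c zpow n \<in> PG}"
  by (simp add: SU11_weight_def Delta_P_def lift_def cls_eq_iff[OF subspace_PG] coact_def tmapr_def)

lemma SU11_weight_Hom: "f \<in> Hom n \<Longrightarrow> cls I f \<in> SU11_weight q n"
proof -
  assume f: "f \<in> Hom n"
  let ?r = "rep (cls I f)"
  have I: "?r - f \<in> I" by (rule rep_cls[OF subspace_I])
  have "coact (?r - f) - (?r - f) \<otimes>\<^sub>c zpow n \<in> PG"
    by (intro cs.subspace_diff[OF subspace_PG] coact_I PG_tens I)
  then show ?thesis
    by (simp add: SU11_weight_alt SU11_def coact.diff tl.diff coact_Hom[OF f])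
qed

text \<open>Taking the coefficient of \<open>zpow n\<close> in the coaction projects any
  representative onto its part of weight \<open>n\<close>; by the weight condition this part lies in
  the same class.\<close>

lemma SU11_weight_obtain:
  assumes "x \<in> SU11_weight q n"
  obtains f where "f \<in> Hom n" "x = cls I f"
proof -
  let ?r = "rep x" and ?c = "idt (\<lambda>m. if m = n then 1 else 0)"
  from assms obtain g where g: "x = cls I g"
    by (auto simp: SU11_weight_alt SU11_def)
  have "?c (coact ?r - ?r \<otimes>\<^sub>c zpow n) \<in> I"
    using assms by (intro PG_idt) (simp add: SU11_weight_alt)
  then have "?c (coact ?r) - ?r \<in> I" by (simp add: idt.diff zpow_def)
  from cs.subspace_add[OF subspace_I this rep_cls[OF subspace_I, of g]]
  have "cls I (?c (coact ?r)) = x"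
    unfolding g by (simp add: cls_eq_iff[OF subspace_I])
  moreover have "?c (coact h) \<in> Hom n" for h
    by (induction h rule: free_induct)
      (auto simp: coact.zero coact.add idt.zero idt.add coact_single Hom_single
        cs.subspace_0[OF subspace_Hom] intro: cs.subspace_add[OF subspace_Hom])
  ultimately show thesis using that by metis
qed

lemma hyperboloid_eq: "hyperboloid q = SU11_weight q 0"
  by (simp add: hyperboloid_def SU11_weight_def zpow_def)

section \<open>The adjoint of a one-form\<close>

lemma antipode_single:
  "antipode q (sng w c) = scl c (prod_list (rev (map (gen_antipode q) (letters w))))"
  by (simp add: antipode_def antialg_ext_def)

sublocale antipode: additive "antipode q"
  unfolding antipode_def antialg_ext_def by (rule additive_lin)

lemma antipode_scl: "antipode q (scl c f) = scl c (antipode q f)"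
  by (simp add: antipode_def antialg_ext_def lin_scl)

lemma antipode_one: "antipode q 1 = 1"
  unfolding one_falg antipode_single by simp

lemma antipode_gn: "antipode q (gn g) = gen_antipode q g"
  by (simp add: gn_def antipode_single)

lemma antipode_mult: "antipode q (a * b) = antipode q b * antipode q a"
proof (induction a rule: free_induct)
  case (single k c)
  show ?case
  proof (induction b rule: free_induct)
    case (single l d)
    then show ?case
      by (simp add: mult_single antipode_single scl_mult_left scl_mult_right mult.commute)
  qed (simp_all add: antipode.zero antipode.add distrib_left distrib_right)
qed (simp_all add: antipode.zero antipode.add distrib_left distrib_right)

text \<open>Both maps reverse products, so the composite is multiplicative and antilinear. For
  \<open>f\<close> with zero counit it represents, up to sign, the adjoint of
  \<open>\<pi>(f)\<close>.\<close>

definition sstar :: "falg \<Rightarrow> falg" where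
  "sstar f = fstar (antipode q f)"

lemma kap_sstar: "kap i (sstar f) = cnj (kap i f)"
proof (induction f rule: falg_induct)
  case (gen g f)
  have "cnj (tw i) = tw i" by (cases i) auto
  then have "kap i (sstar (gn g)) = cnj (kapg i g)"
    by (cases g) (simp_all add: sstar_def antipode_gn fstar_scl lfun_scl fstar.minus lfun.minus)
  then show ?case
    using gen by (simp add: sstar_def antipode_mult fstar_mult kap_mult)
qed (simp_all add: sstar_def antipode_one antipode.add antipode_scl fstar.add fstar_scl lfun.add
    lfun_scl)

lemma counit_sstar: "counit (sstar f) = cnj (counit f)"
proof (induction f rule: falg_induct)
  case (gen g f)
  have "counit (sstar (gn g)) = cnj (gen_counit g)"
    by (cases g)
      (simp_all add: sstar_def antipode_gn fstar_scl counit_scl fstar.minus counit.minus)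
  then show ?case
    using gen by (simp add: sstar_def antipode_mult fstar_mult counit_mult)
qed (simp_all add: sstar_def antipode_one antipode.add antipode_scl fstar.add fstar_scl counit.add
    counit_scl)

text \<open>Allowing for the sign in the adjoint of \<open>\<pi>(f)\<close>, this says that the star
  exchanges \<open>\<eta>\<^sub>-\<close> and \<open>\<eta>\<^sub>+\<close> and that
  \<open>\<pi>(\<alpha>)\<close> is skew-adjoint.\<close>

lemma chi_sstar:
  "chi Minus (sstar f) = - cnj (chi Plus f) \<and> chi Plus (sstar f) = - cnj (chi Minus f) \<and>
   chi Three (sstar f) = cnj (chi Three f)"
proof (induction f rule: falg_induct)
  case (gen g f)
  have g: "chi Minus (sstar (gn g)) = - cnj (chig Plus g) \<and>
    chi Plus (sstar (gn g)) = - cnj (chig Minus g) \<and>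
    chi Three (sstar (gn g)) = cnj (chig Three g)"
    by (cases g) (simp_all add: sstar_def antipode_gn fstar_scl lfun_scl fstar.minus lfun.minus)
  have m: "sstar (gn g * f) = sstar (gn g) * sstar f"
    by (simp add: sstar_def antipode_mult fstar_mult)
  \<comment> \<open>Directions \<open>Minus\<close> and \<open>Plus\<close> are exchanged, so their
    Leibniz rules have to use the same character.\<close>
  have p: "kap Plus f = kap Minus f"
  proof -
    have "kapg Plus = kapg Minus"
    proof
      show "kapg Plus g = kapg Minus g" for g by (cases g) simp_all
    qed
    then have "kapw Plus = kapw Minus" by (auto simp: kapw_def)
    then show ?thesis by simp
  qed
  show ?case
    unfolding m chi_mult kap_sstar counit_sstar
    using gen g counit_sstar[of "gn g"] by (simp add: chi_mult p)
qed (auto simp: sstar_def antipode_one antipode.add antipode_scl fstar.add fstar_scl lfun.add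
    lfun_scl)

section \<open>The adjoint in coordinates\<close>

sublocale star1: additive "star1 q"
  unfolding star1_def by (rule additive_antilin)

lemma star1_single: "star1 q (sng (u, v) c) =
    scl (cnj c) (- ((1 \<otimes>\<^sub>c sstar (sng v 1)) * Delta q (fstar (sng u 1))))"
  by (simp add: star1_def rmul1_def sstar_def)

lemma E_star1: "E (star1 q W) = - fstar (E W)"
proof (rule additive_eqI[of "\<lambda>W. E (star1 q W)" "\<lambda>W. - fstar (E W)"])
  fix k :: "word \<times> word" and c
  obtain u v where k: "k = (u, v)" by (cases k)
  have "sng (u, v) c = scl c (sng u 1) \<otimes>\<^sub>c sng v 1" by simp
  then have "E (sng (u, v) c) = scl (c * counit (sng v 1)) (sng u 1)"
    by (simp only: E_tens cs.scale_scale mult.commute)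
  then show "E (star1 q (sng k c)) = - fstar (E (sng k c))"
    unfolding k star1_single
    by (simp add: E_scl E.minus E_mult counit_sstar fstar_scl scl_mult_left del: scl_single)
qed (simp_all add: additive_def E.add star1.add fstar.add)

text \<open>The terms with \<open>E W\<close> arise because the identity is checked on basis words,
  whose counit may be nonzero; on one-forms they disappear.\<close>

lemma D_star1:
  "D Minus (star1 q W) = sig Minus (fstar (D Plus W)) - der Minus (fstar (E W))"
  "D Plus (star1 q W) = sig Minus (fstar (D Minus W)) - der Plus (fstar (E W))"
  "D Three (star1 q W) = - sig Three (fstar (D Three W)) - der Three (fstar (E W))"
proof -
  have s: "D i (star1 q (sng (u, v) c)) =
      - scl (cnj c * chi i (sstar (sng v 1))) (sig i (fstar (sng u 1)))
      - der i (fstar (E (sng (u, v) c)))"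
    "D i (sng (u, v) c) = scl (c * chi i (sng v 1)) (sng u 1)" for i u v c
  proof -
    have k: "sng (u, v) c = scl c (sng u 1) \<otimes>\<^sub>c sng v 1" by simp
    have "E (sng (u, v) c) = scl (c * counit (sng v 1)) (sng u 1)"
      unfolding k by (simp only: E_tens cs.scale_scale mult.commute)
    then show "D i (star1 q (sng (u, v) c)) =
        - scl (cnj c * chi i (sstar (sng v 1))) (sig i (fstar (sng u 1)))
        - der i (fstar (E (sng (u, v) c)))"
      unfolding star1_single D_scl D.minus D_rmul
      by (simp add: scl_mult_left fstar_scl der_scl counit_sstar cs.scale_right_diff_distrib
          del: scl_single)
    show "D i (sng (u, v) c) = scl (c * chi i (sng v 1)) (sng u 1)"
      unfolding k by (simp only: D_tens cs.scale_scale mult.commute)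
  qed
  note c = chi_sstar[THEN conjunct1] chi_sstar[THEN conjunct2, THEN conjunct1]
    chi_sstar[THEN conjunct2, THEN conjunct2]
  show "D Minus (star1 q W) = sig Minus (fstar (D Plus W)) - der Minus (fstar (E W))"
    by (rule additive_eqI[of "\<lambda>W. D Minus (star1 q W)"
          "\<lambda>W. sig Minus (fstar (D Plus W)) - der Minus (fstar (E W))"])
      (auto simp: additive_def D.add E.add star1.add sig.add der.add fstar.add s c fstar_scl
        sig_scl simp del: scl_single)
  show "D Plus (star1 q W) = sig Minus (fstar (D Minus W)) - der Plus (fstar (E W))"
    by (rule additive_eqI[of "\<lambda>W. D Plus (star1 q W)"
          "\<lambda>W. sig Minus (fstar (D Minus W)) - der Plus (fstar (E W))"])
      (auto simp: additive_def D.add E.add star1.add sig.add der.add fstar.add s c fstar_scl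
        sig_scl sig_Plus simp del: scl_single)
  show "D Three (star1 q W) = - sig Three (fstar (D Three W)) - der Three (fstar (E W))"
    by (rule additive_eqI[of "\<lambda>W. D Three (star1 q W)"
          "\<lambda>W. - sig Three (fstar (D Three W)) - der Three (fstar (E W))"])
      (auto simp: additive_def D.add E.add star1.add sig.add der.add fstar.add s c fstar_scl
        sig_scl simp del: scl_single)
qed

lemma star1_K1: "W \<in> K1 \<Longrightarrow> star1 q W \<in> K1"
proof -
  assume "W \<in> K1"
  then have W: "E W = 0" "\<And>i. D i W \<in> I" by (auto simp: Om1_ker_iff)
  have "D i (star1 q W) \<in> I" for i
    by (cases i) (auto simp: D_star1 W fstar.zero der.zero
        intro!: I_sig I_fstar cs.subspace_neg[OF subspace_I])
  then show ?thesis by (simp add: Om1_ker_iff E_star1 W fstar.zero)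
qed

section \<open>The Laplacians on homogeneous representatives\<close>

lemma SU11_star_cls: "SU11_star q (cls I f) = cls I (fstar f)"
  unfolding SU11_star_def
  by (rule lift_cls[OF subspace_I subspace_I fstar.additive_axioms I_fstar])

lemma SU11_uminus_cls: "SU11_uminus q (cls I f) = cls I (- f)"
  unfolding SU11_uminus_def
  by (rule lift_cls[OF subspace_I subspace_I])
    (simp_all add: additive_def cs.subspace_neg[OF subspace_I])

definition form :: "falg \<Rightarrow> falg \<Rightarrow> falg2" where
  "form x y = lmul1 x (e Minus) + lmul1 y (e Plus)"

lemma E_form [simp]: "E (form x y) = 0"
  and D_form [simp]: "D Minus (form x y) = x" "D Plus (form x y) = y" "D Three (form x y) = 0"
  by (simp_all add: form_def E.add D.add)

lemma cls_form_iff: "cls K1 (form x y) = cls K1 (form x' y') \<longleftrightarrow> x - x' \<in> I \<and> y - y' \<in> I"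
proof -
  have "D i (form x y - form x' y') \<in> I" if "x - x' \<in> I" "y - y' \<in> I" for i
    using that by (cases i) (simp_all add: D.diff cs.subspace_0[OF subspace_I])
  moreover have "x - x' \<in> I \<and> y - y' \<in> I" if "\<And>i. D i (form x y - form x' y') \<in> I"
    using that[of Minus] that[of Plus] by (simp add: D.diff)
  ultimately have "(\<forall>i. D i (form x y - form x' y') \<in> I) \<longleftrightarrow> x - x' \<in> I \<and> y - y' \<in> I"
    by blast
  then show ?thesis
    by (simp add: cls_eq_iff[OF subspace_K1] Om1_ker_iff E.diff)
qed

lemma cls_form_eqI:
  assumes "E W = 0" "D Minus W = x" "D Plus W = y" "D Three W = 0"
  shows "cls K1 W = cls K1 (form x y)"
  unfolding cls_eq_iff[OF subspace_K1]
proof (rule K1_cong)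
  show "D i W - D i (form x y) \<in> I" for i
    by (cases i) (simp_all add: assms cs.subspace_0[OF subspace_I])
qed (simp add: assms)

lemma form1_cls: "form1 q (cls I x) (cls I y) = cls K1 (form x y)"
  using rep_cls[OF subspace_I, of x] rep_cls[OF subspace_I, of y]
  by (simp add: form1_def lift2_def eta_plus_eq eta_minus_eq cls_form_iff flip: form_def)

text \<open>The coefficients of a form are unique modulo the ideal by \<open>cls_form_iff\<close>,
  so the description in \<open>starL1\<close> singles out exactly one value.\<close>

lemma starL1_form:
  assumes "x \<in> Hom 2" "y \<in> Hom (- 2)"
  shows "starL1 q (cls K1 (form x y)) = cls K1 (form (- fstar y) (fstar x))"
  unfolding starL1_def
proof (rule the_equality)
  show "\<exists>x'\<in>SU11_weight q 2. \<exists>y'\<in>SU11_weight q (- 2).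
      cls K1 (form x y) = form1 q x' y' \<and> cls K1 (form (- fstar y) (fstar x)) =
        form1 q (SU11_uminus q (SU11_star q y')) (SU11_star q x')"
    using SU11_weight_Hom[OF assms(1)] SU11_weight_Hom[OF assms(2)]
    by (intro bexI) (auto simp: form1_cls SU11_star_cls SU11_uminus_cls)
next
  fix V
  assume "\<exists>x'\<in>SU11_weight q 2. \<exists>y'\<in>SU11_weight q (- 2).
      cls K1 (form x y) = form1 q x' y' \<and>
      V = form1 q (SU11_uminus q (SU11_star q y')) (SU11_star q x')"
  then obtain x' y' where "x' \<in> SU11_weight q 2" "y' \<in> SU11_weight q (- 2)"
    and *: "cls K1 (form x y) = form1 q x' y'"
      "V = form1 q (SU11_uminus q (SU11_star q y')) (SU11_star q x')" by blast
  then obtain u v where uv: "x' = cls I u" "y' = cls I v"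
    by (metis SU11_weight_obtain)
  with * have "cls I x = x'" "cls I y = y'"
    by (simp_all add: form1_cls cls_form_iff cls_eq_iff[OF subspace_I])
  then show "V = cls K1 (form (- fstar y) (fstar x))"
    unfolding *(2) by (auto simp: form1_cls SU11_star_cls SU11_uminus_cls)
qed

section \<open>Top-degree forms and the codifferentials\<close>

lemma times_dvol_cls: "times_dvol q (cls I p) = cls K2 (lmul2 p (ee Minus Plus))"
  unfolding times_dvol_def eta_plus_eq eta_minus_eq ee_def[symmetric]
  by (rule lift_cls[OF subspace_I subspace_K2 additive_lmul2_left K2_I])

lemma times_dvol_eq_iff: "times_dvol q (cls I p) = times_dvol q (cls I p') \<longleftrightarrow> cls I p = cls I p'"
  unfolding times_dvol_cls cls_eq_iff[OF subspace_I] cls_eq_iff[OF subspace_K2] lmul2_diff[symmetric]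
  by (auto intro: volume_form_free K2_I)

text \<open>The right operator stars its argument twice, so it is plain multiplication by
  \<open>dvol\<close>.\<close>

lemma starL0_cls: "starL0 q (cls I f) = times_dvol q (cls I (fstar f))"
  and starR0_cls: "starR0 q (cls I f) = times_dvol q (cls I f)"
  by (simp_all add: starL0_def starR0_def SU11_star_cls)

lemma inj_starL0: "inj_on (starL0 q) (hyperboloid q)"
proof (rule inj_onI)
  fix b b' assume "b \<in> hyperboloid q" "b' \<in> hyperboloid q" and eq: "starL0 q b = starL0 q b'"
  then obtain f f' where f: "b = cls I f" "b' = cls I f'"
    unfolding hyperboloid_eq by (metis SU11_weight_obtain)
  from eq have "SU11_star q (cls I (fstar f)) = SU11_star q (cls I (fstar f'))"
    unfolding f starL0_cls times_dvol_eq_iff by simp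
  then show "b = b'" by (simp add: SU11_star_cls f)
qed

lemma inj_starR0: "inj_on (starR0 q) (hyperboloid q)"
proof (rule inj_onI)
  fix b b' assume "b \<in> hyperboloid q" "b' \<in> hyperboloid q" and eq: "starR0 q b = starR0 q b'"
  then obtain f f' where f: "b = cls I f" "b' = cls I f'"
    unfolding hyperboloid_eq by (metis SU11_weight_obtain)
  from eq show "b = b'" by (simp add: f starR0_cls times_dvol_eq_iff)
qed

text \<open>Weight zero puts the class of \<open>p\<close> into the set on which
  \<open>starL0\<close> is injective, so \<open>inv_into\<close> returns that class.\<close>

lemma codiffL_eqI:
  assumes "p \<in> Hom 0" "d1_P q (starL1 q w) = times_dvol q (cls I (fstar p))"
  shows "codiffL q w = cls I (- p)"
proof -
  have "inv_into (hyperboloid q) (starL0 q) (d1_P q (starL1 q w)) = cls I p"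
    by (rule inv_into_f_eq[OF inj_starL0])
      (simp_all add: hyperboloid_eq SU11_weight_Hom assms starL0_cls)
  then show ?thesis by (simp add: codiffL_def SU11_uminus_cls)
qed

lemma codiffR_eqI:
  assumes "p \<in> Hom 0" "d1_P q (starR1 q w) = times_dvol q (cls I p)"
  shows "codiffR q w = cls I (- p)"
proof -
  have "inv_into (hyperboloid q) (starR0 q) (d1_P q (starR1 q w)) = cls I p"
    by (rule inv_into_f_eq[OF inj_starR0])
      (simp_all add: hyperboloid_eq SU11_weight_Hom assms starR0_cls)
  then show ?thesis by (simp add: codiffR_def SU11_uminus_cls)
qed

section \<open>Comparison of the two Laplacians\<close>

lemma d1_P_form_class: "x \<in> Hom 2 \<Longrightarrow> y \<in> Hom (- 2) \<Longrightarrow>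
    d1_P q (cls K1 (form x y)) = times_dvol q (cls I (der Minus y - scl (Q^2) (der Plus x)))"
  unfolding form_def times_dvol_cls by (rule d1_P_form)

text \<open>The third coordinate of \<open>df\<close> is \<open>der Three f\<close>, which vanishes
  since \<open>phi 0 = 0\<close>.\<close>

lemma d0_P_cls:
  assumes "f \<in> Hom 0"
  shows "d0_P q (cls I f) = cls K1 (form (der Minus f) (der Plus f))"
proof -
  have "d0_P q (cls I f) = cls K1 (d0 q f)"
    unfolding d0_P_def
    by (rule lift_cls[OF subspace_I subspace_K1 additive_d0]) (simp add: Om1_ker_iff I_der)
  also have "\<dots> = cls K1 (form (der Minus f) (der Plus f))"
    by (rule cls_form_eqI) (simp_all add: der_Three_Hom[OF assms] phi_values)
  finally show ?thesis .
qed

lemma star1_P_form: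
  assumes x: "x \<in> Hom 2" and y: "y \<in> Hom (- 2)"
  shows "star1_P q (cls K1 (form x y)) =
    cls K1 (form (scl (inverse (Q^2)) (fstar y)) (scl (Q^2) (fstar x)))"
proof -
  have "sig Minus (fstar y) = scl (inverse (Q^2)) (fstar y)"
    "sig Minus (fstar x) = scl (Q^2) (fstar x)"
    using sig_Hom[OF Hom_fstar[OF y]] sig_Hom[OF Hom_fstar[OF x]]
    by (simp_all add: power_inverse power_int_minus)
  then have "cls K1 (star1 q (form x y)) =
      cls K1 (form (scl (inverse (Q^2)) (fstar y)) (scl (Q^2) (fstar x)))"
    by (intro cls_form_eqI) (simp_all add: E_star1 D_star1 fstar.zero der.zero sig.zero)
  then show ?thesis
    unfolding star1_P_def
    by (subst lift_cls[OF subspace_K1 subspace_K1 star1.additive_axioms star1_K1])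
qed

lemma laplace_eq:
  assumes f: "f \<in> Hom 0"
  shows "laplaceL q (cls I f) = laplaceR q (cls I f)"
proof -
  let ?x = "der Minus f" and ?y = "der Plus f"
  let ?p = "scl (1 + Q^4) (der Plus (der Minus f))"
  have x: "?x \<in> Hom 2" and y: "?y \<in> Hom (- 2)"
    using Hom_der[OF f, of Minus] Hom_der[OF f, of Plus] by simp_all
  have p: "?p \<in> Hom 0"
    using cs.subspace_scale[OF subspace_Hom Hom_der[OF x, of Plus]] by simp
  have c4: "Q^2 * Q^2 = Q^4" by simp
  \<comment> \<open>In weight zero \<open>der Three f\<close> vanishes, so the commutation rule
    identifies the two mixed second derivatives up to \<open>q^2\<close>.\<close>
  have comm: "der Minus ?y = scl (Q^2) (der Plus ?x)"
    using der_commutator[of f] der_Three_Hom[OF f] by (simp add: phi_values)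
  \<comment> \<open>The second derivatives under the star have weight zero, where
    \<open>sig Minus\<close> acts as the identity.\<close>
  have "der Minus (fstar ?x) = fstar (der Plus ?x)"
    "der Plus (fstar ?y) = fstar (der Minus ?y)"
    using sig_Hom[OF Hom_fstar[OF Hom_der[OF x, of Plus]], of Minus]
      sig_Hom[OF Hom_fstar[OF Hom_der[OF y, of Minus]], of Minus]
    by (simp_all add: der_Minus_fstar der_Plus_fstar)
  then have "der Minus (fstar ?x) - scl (Q^2) (der Plus (- fstar ?y)) = fstar ?p"
    by (simp add: der.minus comm fstar.add fstar_scl c4 cs.scale_left_distrib)
  moreover have "- fstar ?y \<in> Hom 2" "fstar ?x \<in> Hom (- 2)"
    using Hom_fstar[OF x] cs.subspace_neg[OF subspace_Hom Hom_fstar[OF y]] by simp_all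
  ultimately have "d1_P q (starL1 q (cls K1 (form ?x ?y))) = times_dvol q (cls I (fstar ?p))"
    by (simp add: starL1_form[OF x y] d1_P_form_class)
  then have L: "codiffL q (cls K1 (form ?x ?y)) = cls I (- ?p)"
    by (rule codiffL_eqI[OF p])
  let ?x' = "scl (inverse (Q^2)) (fstar ?y)" and ?y' = "scl (Q^2) (fstar ?x)"
  have x': "?x' \<in> Hom 2" and y': "?y' \<in> Hom (- 2)"
    using Hom_fstar[OF x] Hom_fstar[OF y] by (simp_all add: cs.subspace_scale[OF subspace_Hom])
  have "starR1 q (cls K1 (form ?x ?y)) =
      cls K1 (form (- scl (Q^2) ?x) (scl (inverse (Q^2)) ?y))"
    unfolding starR1_def star1_P_form[OF x y] starL1_form[OF x' y'] by (simp add: fstar_scl)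
  \<comment> \<open>Here the summand 1 comes from the derivative of \<open>?y\<close> and
    \<open>Q^4\<close> from that of \<open>?x\<close>, the reverse of the left case; by
    \<open>comm\<close> the totals agree.\<close>
  moreover have "der Minus (scl (inverse (Q^2)) ?y) - scl (Q^2) (der Plus (- scl (Q^2) ?x)) = ?p"
    by (simp add: der_scl der.minus comm c4 cs.scale_left_distrib)
  moreover have "- scl (Q^2) ?x \<in> Hom 2" "scl (inverse (Q^2)) ?y \<in> Hom (- 2)"
    using cs.subspace_neg[OF subspace_Hom cs.subspace_scale[OF subspace_Hom x]]
      cs.subspace_scale[OF subspace_Hom y] by auto
  ultimately have "d1_P q (starR1 q (cls K1 (form ?x ?y))) = times_dvol q (cls I ?p)"
    by (simp add: d1_P_form_class)
  then have R: "codiffR q (cls K1 (form ?x ?y)) = cls I (- ?p)"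
    by (rule codiffR_eqI[OF p])
  show ?thesis
    by (simp add: laplaceL_def laplaceR_def d0_P_cls[OF f] L R)
qed

end

theorem mainTheorem5:
  fixes q :: real
  assumes "- 1 < q" and "q < 1" and "q \<noteq> 0"
  shows "\<forall>b \<in> hyperboloid q. laplaceL q b = laplaceR q b"
proof -
  have "q^2 \<noteq> 1"
    using assms by (auto simp: power2_eq_1_iff)
  with assms(3) interpret su11 q by unfold_locales
  show ?thesis
    unfolding hyperboloid_eq by (metis SU11_weight_obtain laplace_eq)
qed

end
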